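(* Let $S=K[t_1,\ldots,t_s]$ be a polynomial ring over a field $K$, let $I=I(G)$ be the edge ideal of a graph $G$ with vertex set $\{t_1,\ldots,t_s\}$, with minimal set of monomial generators $\{t^{v_1},\ldots,t^{v_q}\}$, and let $I^*$ be the dual of $I$. Let $$\mathcal{B}=\{e_{s+1}\}\cup\{e_i+e_{s+1}\}_{i=1}^s\cup\{(v_i,1)\}_{i=1}^q\subset\mathbb{R}^{s+1}.$$ Then $I^*$ is normal if and only if $\mathcal{B}$ is a Hilbert basis.
   Context: Graphs are finite, with no multiple edges or loops. The edge ideal $I(G)$ is the ideal of $S$ generated by all $t_e:=\prod_{t_i\in e}t_i$ with $e$ an edge of $G$. The dual $I^*$ of $I=I(G)$ is the ideal of $S$ generated by all monomials $t_1\cdots t_s/t_e$ with $e$ an edge of $G$. If $G$ has no edges, $I(G)=(0)$ and $I(G)^*=(0)$. $\mathbb{N}=\{0,1,2,\ldots\}$; $t^a:=t_1^{a_1}\cdots t_s^{a_s}$ for $a\in\mathbb{N}^s$; $e_i$ in the definition of $\mathcal{B}$ is the $i$-th unit vector of $\mathbb{R}^{s+1}$. A finite set $\mathcal{B}\subset\mathbb{R}^{s+1}$ is a Hilbert basis if $\mathbb{Z}^{s+1}\cap\mathbb{R}_+\mathcal{B}=\mathbb{N}\mathcal{B}$, where $\mathbb{R}_+\mathcal{B}$ is the cone generated by $\mathcal{B}$ and $\mathbb{N}\mathcal{B}$ is the semigroup of $\mathbb{N}$-combinations of $\mathcal{B}$. An ideal $J$ is normal if $J^n=\overline{J^n}$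 for all $n\geq 1$, where $\overline{J^n}$ is the integral closure of $J^n$. *)

theory Defs
  imports "HOL-Analysis.Analysis" "HOL-Library.Poly_Mapping"
begin

text \<open>Ideals of a commutative ring, as sets of elements of the ring type.
  An ideal is a submodule of the ring, so the generated ideal is the span for
  the action of the ring on itself by multiplication.\<close>

lemma module_mult: "module ((*) :: 'a::comm_ring_1 \<Rightarrow> 'a \<Rightarrow> 'a)"
  by unfold_locales (simp_all add: algebra_simps)

definition ideal_gen :: "'a::comm_ring_1 set \<Rightarrow> 'a set" where
  "ideal_gen A = module.span (*) A"

lemma ideal_gen_explicit:
  "ideal_gen A = {\<Sum>a\<in>t. r a * a |t r. finite t \<and> t \<subseteq> A}"
  unfolding ideal_gen_def by (rule module.span_explicit [OF module_mult])

definition ideal_mult :: "'a::comm_ring_1 set \<Rightarrow> 'a set \<Rightarrow> 'a set" where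
  "ideal_mult I J = ideal_gen {x * y |x y. x \<in> I \<and> y \<in> J}"

primrec ideal_power :: "'a::comm_ring_1 set \<Rightarrow> nat \<Rightarrow> 'a set" where
  "ideal_power J 0 = UNIV"
| "ideal_power J (Suc n) = ideal_mult J (ideal_power J n)"

definition integral_closure :: "'a::comm_ring_1 set \<Rightarrow> 'a set" where
  "integral_closure J =
    {f. \<exists>n\<ge>1. \<exists>a. (\<forall>i\<in>{1..n}. a i \<in> ideal_power J i) \<and>
          f ^ n + (\<Sum>i=1..n. a i * f ^ (n - i)) = 0}"

definition normal_ideal :: "'a::comm_ring_1 set \<Rightarrow> bool" where
  "normal_ideal J \<longleftrightarrow> (\<forall>n\<ge>1. ideal_power J n = integral_closure (ideal_power J n))"


text \<open>The polynomial ring over \<open>'k\<close> with one variable for each element of \<open>'v\<close>: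
  finitely supported maps from exponent vectors to coefficients, with the
  convolution product.\<close>

type_synonym ('v, 'k) polyring = "('v \<Rightarrow>\<^sub>0 nat) \<Rightarrow>\<^sub>0 'k"

definition var :: "'v \<Rightarrow> ('v, 'k::field) polyring" where
  "var i = Poly_Mapping.single (Poly_Mapping.single i 1) 1"

definition monomial :: "nat ^ 'v \<Rightarrow> ('v::finite, 'k::field) polyring" where
  "monomial a = (\<Prod>i\<in>UNIV. var i ^ (a $ i))"

definition min_monomial_gens :: "(nat ^ 'v) set \<Rightarrow> ('v::finite, 'k::field) polyring set \<Rightarrow> bool" where
  "min_monomial_gens V I \<longleftrightarrow>
     ideal_gen (monomial ` V) = I \<and> (\<forall>W. W \<subset> V \<longrightarrow> ideal_gen (monomial ` W) \<noteq> I)"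


text \<open>A simple graph whose vertex set is the whole finite type \<open>'v\<close> is given by
  its set of edges; an edge is a set of exactly two vertices.\<close>

definition simple_graph :: "'v::finite set set \<Rightarrow> bool" where
  "simple_graph E \<longleftrightarrow> (\<forall>e\<in>E. card e = 2)"

definition edge_monomial :: "'v set \<Rightarrow> ('v::finite, 'k::field) polyring" where
  "edge_monomial e = (\<Prod>i\<in>e. var i)"

definition edge_ideal :: "'v set set \<Rightarrow> ('v::finite, 'k::field) polyring set" where
  "edge_ideal E = ideal_gen (edge_monomial ` E)"

text \<open>The quotient of the product of all variables by the monomial of \<open>e\<close>
  is the product of the variables outside \<open>e\<close>.\<close>

definition co_edge_monomial :: "'v set \<Rightarrow> ('v::finite, 'k::field) polyring" where
  "co_edge_monomial e = (\<Prod>i\<in>UNIV - e. var i)"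

lemma co_edge_monomial_mult:
  "co_edge_monomial e * edge_monomial e = (\<Prod>i\<in>UNIV. var i)"
  unfolding co_edge_monomial_def edge_monomial_def
  by (rule prod.subset_diff [symmetric]) auto

definition dual_edge_ideal :: "'v set set \<Rightarrow> ('v::finite, 'k::field) polyring set" where
  "dual_edge_ideal E = ideal_gen (co_edge_monomial ` E)"


definition integer_points :: "'a::euclidean_space set" where
  "integer_points = {x. \<forall>b\<in>Basis. x \<bullet> b \<in> \<int>}"

definition real_cone :: "'a::euclidean_space set \<Rightarrow> 'a set" where
  "real_cone B = {\<Sum>b\<in>B. c b *\<^sub>R b |c. \<forall>b\<in>B. 0 \<le> c b}"

definition nat_semigroup :: "'a::euclidean_space set \<Rightarrow> 'a set" where
  "nat_semigroup B = {\<Sum>b\<in>B. real (n b) *\<^sub>R b |n. True}"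

definition hilbert_basis :: "'a::euclidean_space set \<Rightarrow> bool" where
  "hilbert_basis B \<longleftrightarrow> finite B \<and> integer_points \<inter> real_cone B = nat_semigroup B"

text \<open>With \<open>s\<close> the number of elements of \<open>'v\<close>, the space of dimension \<open>s + 1\<close> is
  \<open>(real ^ 'v) \<times> real\<close>; the last unit vector is \<open>(0, 1)\<close>.\<close>

definition basis_set :: "(nat ^ 'v::finite) set \<Rightarrow> ((real ^ 'v) \<times> real) set" where
  "basis_set V =
     {(0, 1)} \<union> {(axis i 1, 0) + (0, 1) |i. True} \<union> {((\<chi> i. real (v $ i)), 1) |v. v \<in> V}"

end

theory Submission
  imports Defs
begin

text \<open>
  Both sides of the equivalence say that a real decomposition can be replaced by an integral
  one, and complementing exponents turns one decomposition into the other.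

  Write \<open>\<chi>\<^sub>e\<close> for the indicator vector of an edge \<open>e\<close>. The generators of the dual ideal have the
  exponents \<open>1 - \<chi>\<^sub>e\<close>, so a monomial \<open>t\<^sup>a\<close> lies in the \<open>n\<close>-th power of the dual ideal iff the
  edges can be given natural weights of total \<open>n\<close> such that, at each vertex \<open>i\<close>, the weights of
  the edges through \<open>i\<close> add up to at least \<open>n - a\<^sub>i\<close>. It lies in the integral closure iff this is
  possible with nonnegative real weights. One half of this is the fact that integral elements have
  their exponents in the Newton polyhedron (\<open>integral_closure_Newton\<close>). For the other half,
  simultaneous Diophantine approximation turns real weights into rational ones
  (\<open>covers_rational\<close>), and then a power of the monomial lies in the same power of the ideal.
  Thus normality means that real edge weights can be made integral
  (\<open>normal_dual_edge_ideal_iff\<close>).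

  The vectors in the theorem are \<open>(\<chi>\<^sub>S, 1)\<close> for the faces \<open>S\<close> of the graph: the empty set, the
  vertices and the edges. They form a Hilbert basis iff every integral vector that is represented
  by nonnegative real weights on faces is also represented by natural weights on faces.
  Representations by faces and covers by edges can be exchanged without changing the total weight.
  Deleting a vertex from a face gives a face, so a cover by edges can be thinned out to hit a
  prescribed smaller vector exactly (\<open>covers_imp_represents\<close>). In the other direction a face can be
  enlarged to an edge (\<open>covers_by_larger_sets\<close>), unless it is an isolated vertex or the graph has no
  edges. The weight of an isolated vertex is a coordinate of the represented vector, hence already
  integral, and in a graph without edges the weight left for the empty face is then integral as
  well.
\<close>

section \<open>Monomial ideals and their powers\<close>

definition multiples :: "'a::comm_monoid_add set \<Rightarrow> 'a set" where
  "multiples W = {w + c |w c. w \<in> W}"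

text \<open>An ideal generated by monomials is determined by the exponents of its monomials, and a
  polynomial belongs to it as soon as all its exponents do. Exponents come from an arbitrary
  commutative monoid here, and the monomial with exponent \<open>w\<close> is \<open>Poly_Mapping.single w 1\<close>.\<close>

definition supported_on :: "'a set \<Rightarrow> ('a \<Rightarrow>\<^sub>0 'k::comm_ring_1) set" where
  "supported_on U = {f. Poly_Mapping.keys f \<subseteq> U}"

text \<open>The exponents of the \<open>n\<close>-th power of the monomial ideal generated by \<open>W\<close>. Starting from
  \<open>UNIV\<close>, the exponents of the unit ideal, builds in the closure under adding arbitrary
  exponents, so that \<open>power_exps W 1 = multiples W\<close>.\<close>

primrec power_exps :: "'a::comm_monoid_add set \<Rightarrow> nat \<Rightarrow> 'a set" where
  "power_exps W 0 = UNIV"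
| "power_exps W (Suc n) = {w + b |w b. w \<in> W \<and> b \<in> power_exps W n}"

global_interpretation ring_module: module "(*) :: 'r::comm_ring_1 \<Rightarrow> 'r \<Rightarrow> 'r"
  by (rule module_mult)

lemma poly_mapping_sum_singles:
  fixes f :: "'a \<Rightarrow>\<^sub>0 'k::comm_monoid_add"
  shows "f = (\<Sum>k\<in>Poly_Mapping.keys f. Poly_Mapping.single k (Poly_Mapping.lookup f k))"
proof (rule poly_mapping_eqI)
  fix k
  show "Poly_Mapping.lookup f k = Poly_Mapping.lookup (\<Sum>k\<in>Poly_Mapping.keys f. Poly_Mapping.single k (Poly_Mapping.lookup f k)) k"
    by (simp add: lookup_sum lookup_single when_def in_keys_iff)
qed

lemma subspace_supported_on:
  fixes U :: "'a::comm_monoid_add set"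
  assumes "\<And>u c. u \<in> U \<Longrightarrow> u + c \<in> U"
  shows "ring_module.subspace (supported_on U :: ('a \<Rightarrow>\<^sub>0 'k::comm_ring_1) set)"
proof (rule ring_module.subspaceI)
  fix f g :: "'a \<Rightarrow>\<^sub>0 'k" 
  assume "f \<in> supported_on U" "g \<in> supported_on U"
  then show "f + g \<in> supported_on U"
    using keys_add[of f g] by (auto simp: supported_on_def)
next
  fix r f :: "'a \<Rightarrow>\<^sub>0 'k" 
  assume "f \<in> supported_on U"
  moreover have "a + b \<in> U" if "b \<in> U" for a b
    using assms[OF that, of a] by (simp add: add.commute)
  ultimately show "r * f \<in> supported_on U"
    using keys_mult[of r f] unfolding supported_on_def by blast
qed (simp add: supported_on_def)

lemma in_ideal_gen_if_singles:
  fixes A :: "('a::comm_monoid_add \<Rightarrow>\<^sub>0 'k::comm_ring_1) set"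
  assumes "\<And>k x. k \<in> Poly_Mapping.keys f \<Longrightarrow> Poly_Mapping.single k x \<in> ideal_gen A"
  shows "f \<in> ideal_gen A"
  by (subst poly_mapping_sum_singles, unfold ideal_gen_def, rule ring_module.span_sum)
     (use assms in \<open>auto simp: ideal_gen_def\<close>)

lemma ideal_gen_monomials:
  "ideal_gen ((\<lambda>w. Poly_Mapping.single w 1) ` W)
     = (supported_on (multiples W) :: ('a::comm_monoid_add \<Rightarrow>\<^sub>0 'k::comm_ring_1) set)"
proof
  show "ideal_gen ((\<lambda>w. Poly_Mapping.single w 1) ` W)
     \<subseteq> (supported_on (multiples W) :: ('a \<Rightarrow>\<^sub>0 'k) set)"
    unfolding ideal_gen_def
  proof (rule ring_module.span_minimal)
    show "ring_module.subspace (supported_on (multiples W) :: ('a \<Rightarrow>\<^sub>0 'k) set)"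
    proof (rule subspace_supported_on)
      fix u c :: 'a assume "u \<in> multiples W"
      then obtain w d where "w \<in> W" "u = w + d" by (auto simp: multiples_def)
      then show "u + c \<in> multiples W"
        by (auto simp: multiples_def add.assoc)
    qed
  next
    have "w \<in> multiples W" if "w \<in> W" for w
      unfolding multiples_def using that by (metis (mono_tags, lifting) add_0_right mem_Collect_eq)
    then show "(\<lambda>w. Poly_Mapping.single w 1) ` W \<subseteq> (supported_on (multiples W) :: ('a \<Rightarrow>\<^sub>0 'k) set)"
      by (auto simp: supported_on_def)
  qed
next
  show "(supported_on (multiples W) :: ('a \<Rightarrow>\<^sub>0 'k) set) \<subseteq> ideal_gen ((\<lambda>w. Poly_Mapping.single w 1) ` W)"
  proof
    fix f :: "'a \<Rightarrow>\<^sub>0 'k" assume f: "f \<in> supported_on (multiples W)"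
    show "f \<in> ideal_gen ((\<lambda>w. Poly_Mapping.single w 1) ` W)"
    proof (rule in_ideal_gen_if_singles)
      fix k :: 'a and x :: 'k assume "k \<in> Poly_Mapping.keys f"
      with f obtain w c where k: "w \<in> W" "k = w + c"
        by (auto simp: supported_on_def multiples_def)
      have "Poly_Mapping.single k x = Poly_Mapping.single c x * Poly_Mapping.single w 1"
        by (simp add: mult_single k add.commute)
      then show "Poly_Mapping.single k x \<in> ideal_gen ((\<lambda>w. Poly_Mapping.single w 1) ` W)"
        using k(1) by (simp add: ideal_gen_def ring_module.span_scale ring_module.span_base)
    qed
  qed
qed

lemma power_exps_add_right: "u \<in> power_exps W n \<Longrightarrow> u + c \<in> power_exps W n"
  by (induction n arbitrary: u) (force simp: add.assoc)+

lemma multiples_power_exps: "multiples (power_exps W n) = power_exps W n"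
proof
  show "multiples (power_exps W n) \<subseteq> power_exps W n"
    by (auto simp: multiples_def power_exps_add_right)
  show "power_exps W n \<subseteq> multiples (power_exps W n)"
    unfolding multiples_def by (metis (mono_tags, lifting) add_0_right mem_Collect_eq subsetI)
qed

text \<open>The induction step multiplies term by term: an exponent of \<open>x * y\<close> is a sum of an exponent
  of \<open>x\<close> and one of \<open>y\<close>, so products create no exponents other than the expected ones, and
  conversely every expected monomial is itself such a product.\<close>

lemma ideal_power_monomials:
  assumes J: "J = (supported_on (multiples W) :: ('a::comm_monoid_add \<Rightarrow>\<^sub>0 'k::comm_ring_1) set)"
  shows "ideal_power J n = supported_on (power_exps W n)"
proof (induction n)
  case 0
  show ?case by (simp add: supported_on_def)
next
  case (Suc n)
  let ?P = "{x * y |x y. x \<in> J \<and> y \<in> ideal_power J n}"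
  have "ideal_gen ?P \<subseteq> supported_on (power_exps W (Suc n))"
    unfolding ideal_gen_def
  proof (rule ring_module.span_minimal)
    show "?P \<subseteq> supported_on (power_exps W (Suc n))"
    proof clarsimp
      fix x y assume xy: "x \<in> J" "y \<in> ideal_power J n"
      show "x * y \<in> supported_on {w + b |w b. w \<in> W \<and> b \<in> power_exps W n}"
      proof -
        have "\<exists>w b. k = w + b \<and> w \<in> W \<and> b \<in> power_exps W n"
          if "k \<in> Poly_Mapping.keys (x * y)" for k
        proof -
          obtain a b where k: "k = a + b" "a \<in> Poly_Mapping.keys x" "b \<in> Poly_Mapping.keys y"
            using \<open>k \<in> _\<close> keys_mult[of x y] by blast
          obtain w c where "w \<in> W" "a = w + c"
            using xy(1) k(2) by (auto simp: J supported_on_def multiples_def)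
          moreover have "b + c \<in> power_exps W n"
            using xy(2) k(3) by (auto simp: Suc supported_on_def intro: power_exps_add_right)
          ultimately show ?thesis
            using k(1) by (metis add.assoc add.commute)
        qed
        then show ?thesis by (auto simp: supported_on_def)
      qed
    qed
    show "ring_module.subspace (supported_on (power_exps W (Suc n)) :: ('a \<Rightarrow>\<^sub>0 'k) set)"
      by (rule subspace_supported_on) (rule power_exps_add_right)
  qed
  moreover have "supported_on (power_exps W (Suc n)) \<subseteq> ideal_gen ?P"
  proof
    fix f :: "'a \<Rightarrow>\<^sub>0 'k" assume f: "f \<in> supported_on (power_exps W (Suc n))"
    show "f \<in> ideal_gen ?P"
    proof (rule in_ideal_gen_if_singles)
      fix k :: 'a and x :: 'k assume "k \<in> Poly_Mapping.keys f"
      with f obtain w b where k: "w \<in> W" "k = w + b" "b \<in> power_exps W n"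
        by (auto simp: supported_on_def)
      have "Poly_Mapping.single w 1 \<in> J"
        unfolding J ideal_gen_monomials[symmetric] ideal_gen_def
        using k(1) by (intro ring_module.span_base) auto
      moreover have "Poly_Mapping.single b x \<in> ideal_power J n"
        using k(3) by (auto simp: Suc supported_on_def)
      moreover have "Poly_Mapping.single k x = Poly_Mapping.single w 1 * Poly_Mapping.single b x"
        by (simp add: mult_single k)
      ultimately show "Poly_Mapping.single k x \<in> ideal_gen ?P"
        unfolding ideal_gen_def by (intro ring_module.span_base) blast
    qed
  qed
  ultimately show ?case by (simp add: ideal_mult_def)
qed

lemma power_exps_add:
  "power_exps W (m + n) = {x + y |x y. x \<in> power_exps W m \<and> y \<in> power_exps W n}"
proof (induction m)
  case 0
  have "multiples (power_exps W n) = {x + y |x y. x \<in> UNIV \<and> y \<in> power_exps W n}"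
    unfolding multiples_def by (subst add.commute) auto
  then show ?case by (simp add: multiples_power_exps)
next
  case (Suc m)
  have "{w + b |w b. w \<in> W \<and> b \<in> {x + y |x y. x \<in> X \<and> y \<in> Y}}
      = {x + y |x y. x \<in> {w + b |w b. w \<in> W \<and> b \<in> X} \<and> y \<in> Y}" for X Y
  proof (intro equalityI subsetI)
    fix z assume "z \<in> {w + b |w b. w \<in> W \<and> b \<in> {x + y |x y. x \<in> X \<and> y \<in> Y}}"
    then obtain w x y where "w \<in> W" "x \<in> X" "y \<in> Y" "z = (w + x) + y"
      by (auto simp: add.assoc)
    then show "z \<in> {x + y |x y. x \<in> {w + b |w b. w \<in> W \<and> b \<in> X} \<and> y \<in> Y}" by blast
  next
    fix z assume "z \<in> {x + y |x y. x \<in> {w + b |w b. w \<in> W \<and> b \<in> X} \<and> y \<in> Y}"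
    then obtain w x y where "w \<in> W" "x \<in> X" "y \<in> Y" "z = w + (x + y)"
      by (auto simp: add.assoc)
    then show "z \<in> {w + b |w b. w \<in> W \<and> b \<in> {x + y |x y. x \<in> X \<and> y \<in> Y}}" by blast
  qed
  then show ?case by (simp only: Suc power_exps.simps add_Suc)
qed

text \<open>On exponents this is the identity \<open>(J ^ n) ^ m = J ^ (n * m)\<close> for monomial ideals.\<close>

lemma power_exps_mult: "power_exps (power_exps W n) m = power_exps W (n * m)"
  by (induction m) (auto simp: power_exps_add)

section \<open>Integral closure of monomial ideals\<close>

text \<open>An element \<open>f\<close> of the ideal is a root of the monic polynomial \<open>X - f\<close>.\<close>

lemma subset_integral_closure:
  fixes J :: "'r::comm_ring_1 set"
  assumes "ring_module.subspace J" shows "J \<subseteq> integral_closure J"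
proof
  fix f assume f: "f \<in> J"
  have "- f * 1 \<in> ideal_gen {x * y |x y. x \<in> J \<and> y \<in> UNIV}"
    unfolding ideal_gen_def using assms f
    by (intro ring_module.span_base) (use ring_module.subspace_neg in blast)
  then show "f \<in> integral_closure J"
    unfolding integral_closure_def
    by (auto simp: ideal_mult_def intro!: exI[of _ 1] exI[of _ "\<lambda>_. - f"])
qed

lemma single_power:
  "Poly_Mapping.single k x ^ n = Poly_Mapping.single (\<Sum>i<n. k) (x ^ n :: 'k::comm_ring_1)"
  by (induction n) (simp_all add: mult_single add.commute)

text \<open>An element with a power in the same power of \<open>J\<close> is a root of \<open>X ^ m - f ^ m\<close>.\<close>

lemma integral_closure_if_power_in:
  fixes f :: "'r::comm_ring_1"
  assumes "1 \<le> m" "- (f ^ m) \<in> ideal_power J m" "\<And>i. 0 \<in> ideal_power J i"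
  shows "f \<in> integral_closure J"
proof -
  let ?a = "\<lambda>i. if i = m then - (f ^ m) else 0"
  have "(\<Sum>i=1..m. ?a i * f ^ (m - i)) = (\<Sum>i\<in>{m}. ?a i * f ^ (m - i))"
    using assms(1) by (intro sum.mono_neutral_right) auto
  then have "f ^ m + (\<Sum>i=1..m. ?a i * f ^ (m - i)) = 0" by simp
  moreover have "\<forall>i\<in>{1..m}. ?a i \<in> ideal_power J i" using assms by auto
  ultimately show ?thesis
    unfolding integral_closure_def using assms(1)
    by (intro CollectI exI[of _ m] exI[of _ ?a] conjI)
qed

text \<open>If \<open>a + b\<close> arises from only one pair of exponents of the factors, then its coefficient in
  the product is a single product of coefficients, and no cancellation is possible.\<close>

lemma lookup_mult_unique:
  fixes f g :: "'a::cancel_comm_monoid_add \<Rightarrow>\<^sub>0 'k::comm_ring_1"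
  assumes "\<And>x y. x \<in> Poly_Mapping.keys f \<Longrightarrow> y \<in> Poly_Mapping.keys g \<Longrightarrow> x + y = a + b \<Longrightarrow> x = a"
  shows "Poly_Mapping.lookup (f * g) (a + b) = Poly_Mapping.lookup f a * Poly_Mapping.lookup g b"
proof -
  define f' where "f' = f - Poly_Mapping.single a (Poly_Mapping.lookup f a)"
  have key: "x \<in> Poly_Mapping.keys f \<and> x \<noteq> a" if "x \<in> Poly_Mapping.keys f'" for x
    using that by (auto simp: f'_def in_keys_iff lookup_minus lookup_single when_def split: if_splits)
  have "a + b \<notin> Poly_Mapping.keys (f' * g)"
    using keys_mult[of f' g] key assms by (smt (verit) mem_Collect_eq subset_iff)
  then have "Poly_Mapping.lookup (f' * g) (a + b) = 0" by (simp add: in_keys_iff)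
  moreover have "Poly_Mapping.lookup (Poly_Mapping.single a c * g) (a + b) = c * Poly_Mapping.lookup g b" for c
  proof -
    have "Poly_Mapping.lookup (Poly_Mapping.single a c * g) (a + b)
        = (\<Sum>l. (c when a = l) * (\<Sum>q. Poly_Mapping.lookup g q when a + b = l + q))"
      by (simp add: lookup_mult lookup_single)
    also have "\<dots> = (\<Sum>l. (c * (\<Sum>q. Poly_Mapping.lookup g q when a + b = l + q)) when a = l)"
      by (simp add: when_mult)
    also have "\<dots> = c * (\<Sum>q. Poly_Mapping.lookup g q when a + b = a + q)"
      by simp
    also have "\<dots> = c * Poly_Mapping.lookup g b" by simp
    finally show ?thesis .
  qed
  moreover have "f * g = f' * g + Poly_Mapping.single a (Poly_Mapping.lookup f a) * g"
    by (simp add: f'_def algebra_simps)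
  ultimately show ?thesis by (simp add: lookup_add)
qed

text \<open>The initial term of a power is the power of the initial term: a sum of \<open>j\<close> exponents of \<open>f\<close>
  other than \<open>p, \<dots>, p\<close> is strictly larger than that of \<open>j\<close> copies of \<open>p\<close>, so nothing can cancel
  there. The exponent \<open>j\<close> times \<open>p\<close> is written as a sum of
  \<open>j\<close> copies because a commutative monoid comes without multiplication by natural numbers.\<close>

lemma minimal_term_power:
  fixes f :: "'a::cancel_comm_monoid_add \<Rightarrow>\<^sub>0 'k::comm_ring_1"
  assumes irrefl: "\<And>x. \<not> lt x x"
    and trans: "\<And>x y z. lt x y \<Longrightarrow> lt y z \<Longrightarrow> lt x z"
    and add: "\<And>x y z. lt x y \<Longrightarrow> lt (x + z) (y + z)"
    and min: "\<And>x. x \<in> Poly_Mapping.keys f \<Longrightarrow> x = p \<or> lt p x"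
  shows "Poly_Mapping.lookup (f ^ j) (\<Sum>i<j. p) = Poly_Mapping.lookup f p ^ j
    \<and> (\<forall>u\<in>Poly_Mapping.keys (f ^ j). u = (\<Sum>i<j. p) \<or> lt (\<Sum>i<j. p) u)"
proof (induction j)
  case 0
  show ?case by (auto simp: lookup_one)
next
  case (Suc j)
  let ?q = "\<Sum>i<j. p"
  have *: "x = p \<and> y = ?q \<or> lt (p + ?q) (x + y)"
    if "x \<in> Poly_Mapping.keys f" "y \<in> Poly_Mapping.keys (f ^ j)" for x y
  proof -
    have 1: "x = p \<or> lt (p + ?q) (x + ?q)" using min[OF that(1)] add by blast
    have 2: "y = ?q \<or> lt (x + ?q) (x + y)" using Suc that(2) add by (metis add.commute)
    show ?thesis using 1 2 trans by metis
  qed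
  have "Poly_Mapping.lookup (f * f ^ j) (p + ?q) = Poly_Mapping.lookup f p * Poly_Mapping.lookup (f ^ j) ?q"
    by (rule lookup_mult_unique) (metis * irrefl)
  moreover have "u = p + ?q \<or> lt (p + ?q) u" if "u \<in> Poly_Mapping.keys (f * f ^ j)" for u
    using that keys_mult[of f "f ^ j"] * by blast
  ultimately show ?case using Suc by (simp add: add.commute)
qed

definition real_exp :: "('v::finite \<Rightarrow>\<^sub>0 nat) \<Rightarrow> real ^ 'v" where
  "real_exp a = (\<chi> i. real (Poly_Mapping.lookup a i))"

lemma real_exp_nth: "real_exp a $ i = real (Poly_Mapping.lookup a i)"
  by (simp add: real_exp_def)

lemma real_exp_add: "real_exp (a + b) = real_exp a + real_exp b"
  by (simp add: real_exp_def vec_eq_iff lookup_add)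

lemma real_exp_sum_const: "real_exp (\<Sum>i<n. a) = real n *\<^sub>R real_exp a"
  by (simp add: real_exp_def vec_eq_iff lookup_sum)

lemma real_exp_inject: "real_exp a = real_exp b \<longleftrightarrow> a = b"
  by (auto simp: real_exp_def vec_eq_iff intro: poly_mapping_eqI)

lemma power_exps_half_space:
  assumes U: "\<And>u c. u \<in> U \<Longrightarrow> u + c \<in> U" and gt: "\<And>u. u \<in> U \<Longrightarrow> b < \<omega> \<bullet> real_exp u"
  shows "u \<in> power_exps U (Suc i) \<Longrightarrow> real (Suc i) * b < \<omega> \<bullet> real_exp u"
proof (induction i arbitrary: u)
  case 0
  then show ?case using U gt by auto
next
  case (Suc i)
  then obtain w v where "u = w + v" "w \<in> U" "v \<in> power_exps U (Suc i)" by auto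
  then have "b + real (Suc i) * b < \<omega> \<bullet> real_exp u"
    unfolding real_exp_add inner_add_right \<open>u = w + v\<close>
    using Suc.IH[of v] gt[of w] by linarith
  then show ?case by (simp add: algebra_simps)
qed

text \<open>If \<open>f\<close> has an exponent outside \<open>D\<close>, then a separating functional \<open>\<omega>\<close> is smaller there
  than anywhere on \<open>D\<close>. Let \<open>p\<close> be an exponent of \<open>f\<close> at which \<open>\<omega>\<close> is minimal and which has the largest norm
  among those. This tie-break makes \<open>p\<close> an extreme point, so \<open>N p\<close> is an exponent of \<open>f ^ N\<close>. In
  the integral equation no other summand can cancel it: a summand \<open>a\<^sub>i f ^ (N - i)\<close> has
  exponents with \<open>i\<close> summands from \<open>D\<close> and \<open>N - i\<close> from \<open>f\<close>, so that \<open>\<omega>\<close> is strictly larger on them than at \<open>N p\<close>. The smallest choice of \<open>D\<close> is the Newton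
  polyhedron of the ideal.\<close>

lemma integral_closure_Newton:
  fixes f :: "('v::finite, 'k::field) polyring" and U :: "('v \<Rightarrow>\<^sub>0 nat) set"
  assumes U: "\<And>u c. u \<in> U \<Longrightarrow> u + c \<in> U"
    and D: "convex D" "closed D" "real_exp ` U \<subseteq> D"
    and f: "f \<in> integral_closure (supported_on U)"
  shows "real_exp ` Poly_Mapping.keys f \<subseteq> D"
proof (rule ccontr)
  assume "\<not> real_exp ` Poly_Mapping.keys f \<subseteq> D"
  then obtain x0 where x0: "x0 \<in> Poly_Mapping.keys f" "real_exp x0 \<notin> D" by auto
  obtain \<omega> b where \<omega>: "\<omega> \<bullet> real_exp x0 < b" "\<And>x. x \<in> D \<Longrightarrow> b < \<omega> \<bullet> x"
    using separating_hyperplane_closed_point[OF D(1,2) x0(2)] by auto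
  define h where "h x = \<omega> \<bullet> real_exp x" for x :: "'v \<Rightarrow>\<^sub>0 nat"
  define M where "M = Min (h ` Poly_Mapping.keys f)"
  define F where "F = {x \<in> Poly_Mapping.keys f. h x = M}"
  have M: "M \<le> h x" if "x \<in> Poly_Mapping.keys f" for x
    using that by (simp add: M_def)
  have "M \<in> h ` Poly_Mapping.keys f" unfolding M_def using x0(1) by (intro Min_in) auto
  then have F: "finite F" "F \<noteq> {}" by (auto simp: F_def)
  have Mb: "M < b" using M[OF x0(1)] \<omega>(1) by (simp add: h_def)
  have "Max ((\<lambda>x. norm (real_exp x)) ` F) \<in> (\<lambda>x. norm (real_exp x)) ` F"
    using F by (intro Max_in) auto
  then obtain p where p: "p \<in> F" "norm (real_exp p) = Max ((\<lambda>x. norm (real_exp x)) ` F)"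
    by auto
  then have pmax: "norm (real_exp x) \<le> norm (real_exp p)" if "x \<in> F" for x
    using that F by simp
  \<comment> \<open>Compare by \<open>\<omega>\<close>, then by the reversed inner product with \<open>p\<close>: among the
      vectors whose norm is at most that of \<open>p\<close>, only \<open>p\<close> itself has the largest inner product
      with \<open>p\<close>.\<close>
  define lt where "lt x y \<longleftrightarrow> h x < h y \<or> h x = h y \<and> real_exp p \<bullet> real_exp y < real_exp p \<bullet> real_exp x" for x y
  have min: "x = p \<or> lt p x" if "x \<in> Poly_Mapping.keys f" for x
  proof (cases "h x = M")
    case True
    then have xF: "x \<in> F" using that by (simp add: F_def)
    have "x = p" if "\<not> real_exp p \<bullet> real_exp x < real_exp p \<bullet> real_exp p"
    proof -
      \<comment> \<open>Equality in Cauchy-Schwarz: \<open>p \<bullet> x \<ge> p \<bullet> p\<close> and \<open>norm x \<le> norm p\<close> force \<open>x = p\<close>.\<close>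
      have "norm (real_exp x - real_exp p) ^ 2
          = norm (real_exp x) ^ 2 - 2 * (real_exp p \<bullet> real_exp x) + norm (real_exp p) ^ 2"
        by (simp add: power2_norm_eq_inner algebra_simps inner_commute)
      also have "\<dots> \<le> 0"
        using that power_mono[OF pmax[OF xF] norm_ge_zero, of 2]
        by (simp add: power2_norm_eq_inner)
      finally show ?thesis by (simp add: real_exp_inject)
    qed
    then show ?thesis using True p(1) by (auto simp: lt_def F_def)
  next
    case False
    then have "M < h x" using M[OF that] by simp
    then show ?thesis using p(1) by (simp add: lt_def F_def)
  qed
  have pow: "Poly_Mapping.lookup (f ^ j) (\<Sum>i<j. p) = Poly_Mapping.lookup f p ^ j"
    "\<forall>u\<in>Poly_Mapping.keys (f ^ j). u = (\<Sum>i<j. p) \<or> lt (\<Sum>i<j. p) u" for j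
  proof -
    have "Poly_Mapping.lookup (f ^ j) (\<Sum>i<j. p) = Poly_Mapping.lookup f p ^ j
       \<and> (\<forall>u\<in>Poly_Mapping.keys (f ^ j). u = (\<Sum>i<j. p) \<or> lt (\<Sum>i<j. p) u)"
      by (rule minimal_term_power)
        (use min in \<open>auto simp: lt_def h_def real_exp_add inner_add_right\<close>)
    then show "Poly_Mapping.lookup (f ^ j) (\<Sum>i<j. p) = Poly_Mapping.lookup f p ^ j"
      "\<forall>u\<in>Poly_Mapping.keys (f ^ j). u = (\<Sum>i<j. p) \<or> lt (\<Sum>i<j. p) u" by auto
  qed
  have hp: "h (\<Sum>i<j. p) = real j * M" for j
    using p(1) by (simp add: h_def real_exp_sum_const F_def)
  obtain N a where Na: "N \<ge> 1" "\<forall>i\<in>{1..N}. a i \<in> ideal_power (supported_on U) i"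
    "f ^ N + (\<Sum>i=1..N. a i * f ^ (N - i)) = 0"
    using f by (auto simp: integral_closure_def)
  have mU: "multiples U = U"
    using U unfolding multiples_def by (auto simp: ) (metis add_0_right)
  have "(\<Sum>i<N. p) \<notin> Poly_Mapping.keys (a i * f ^ (N - i))" if i: "i \<in> {1..N}" for i
  proof
    assume "(\<Sum>i<N. p) \<in> Poly_Mapping.keys (a i * f ^ (N - i))"
    then obtain u y where uy: "(\<Sum>i<N. p) = u + y" "u \<in> Poly_Mapping.keys (a i)"
      "y \<in> Poly_Mapping.keys (f ^ (N - i))"
      using keys_mult[of "a i" "f ^ (N - i)"] by blast
    have "ideal_power (supported_on U) i = (supported_on (power_exps U i) :: ('v,'k) polyring set)"
      by (rule ideal_power_monomials) (simp add: mU)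
    then have "u \<in> power_exps U i" using Na(2) i uy(2) by (auto simp: supported_on_def)
    then have "u \<in> power_exps U (Suc (i - 1))" using i by simp
    then have "real (Suc (i - 1)) * b < h u"
      unfolding h_def by (rule power_exps_half_space[rotated -1]) (use U \<omega>(2) D(3) in auto)
    then have "real i * b < h u" using i by simp
    moreover have "real (N - i) * M \<le> h y"
      using pow(2)[of "N - i"] uy(3) hp[of "N - i"] by (auto simp: lt_def)
    moreover have "h u + h y = real N * M"
      using hp[of N] uy(1) by (simp add: h_def real_exp_add inner_add_right)
    moreover have "real (N - i) * M = real N * M - real i * M"
      using i by (simp add: of_nat_diff left_diff_distrib)
    ultimately have "real i * b < real i * M" by linarith
    then show False using Mb i by (simp add: mult_less_cancel_left)
  qed
  then have "Poly_Mapping.lookup (\<Sum>i=1..N. a i * f ^ (N - i)) (\<Sum>i<N. p) = 0"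
    by (simp add: lookup_sum in_keys_iff)
  moreover have "Poly_Mapping.lookup (f ^ N + (\<Sum>i=1..N. a i * f ^ (N - i))) (\<Sum>i<N. p) = 0"
    by (simp only: Na(3) lookup_zero)
  ultimately have "Poly_Mapping.lookup f p ^ N = 0"
    using pow(1)[of N] by (simp add: lookup_add)
  then show False using p(1) by (simp add: F_def in_keys_iff)
qed

section \<open>Weighted families of sets\<close>

text \<open>A weight \<open>c\<close> on a family of sets puts the vector \<open>\<Sum>S\<in>F. c S\<close> times the indicator of \<open>S\<close> on
  the vertices; its coordinate at \<open>i\<close> is the load of \<open>i\<close>.\<close>

definition load :: "'v set set \<Rightarrow> ('v set \<Rightarrow> real) \<Rightarrow> 'v \<Rightarrow> real" where
  "load F c i = (\<Sum>S\<in>F. of_bool (i \<in> S) * c S)"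

text \<open>Nonnegative real weights describe the points of a cone, natural weights those of a
  semigroup. Both the nonnegative reals and the natural numbers satisfy the following closure
  properties, and these are all that redistributing weights requires, so the redistribution
  arguments are given once for both.\<close>

definition weight_domain :: "real set \<Rightarrow> bool" where
  "weight_domain A \<longleftrightarrow> 0 \<in> A \<and> (\<forall>x\<in>A. 0 \<le> x) \<and> (\<forall>x\<in>A. \<forall>y\<in>A. x + y \<in> A)
     \<and> (\<forall>x\<in>A. \<forall>y\<in>A. y \<le> x \<longrightarrow> x - y \<in> A)"

text \<open>The two predicates differ in \<open>=\<close> against \<open>\<le>\<close>: a point of the cone over the faces of
  the graph is represented exactly, whereas a monomial lies in an ideal as soon as it is
  divisible by a generator, which becomes an inequality of exponents.\<close>

definition represents :: "real set \<Rightarrow> 'v set set \<Rightarrow> ('v \<Rightarrow> real) \<Rightarrow> real \<Rightarrow> bool" where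
  "represents A F x y \<longleftrightarrow> (\<exists>c. (\<forall>S\<in>F. c S \<in> A) \<and> sum c F = y \<and> (\<forall>i. load F c i = x i))"

definition covers :: "real set \<Rightarrow> 'v set set \<Rightarrow> ('v \<Rightarrow> real) \<Rightarrow> real \<Rightarrow> bool" where
  "covers A F x y \<longleftrightarrow> (\<exists>c. (\<forall>S\<in>F. c S \<in> A) \<and> sum c F = y \<and> (\<forall>i. x i \<le> load F c i))"

lemma weight_domain_nonneg: "weight_domain {0..}"
  by (auto simp: weight_domain_def)

lemma weight_domain_Nats: "weight_domain \<nat>"
  unfolding weight_domain_def
proof (intro conjI ballI impI)
  fix x y :: real assume "x \<in> \<nat>" "y \<in> \<nat>" "y \<le> x"
  then show "x - y \<in> \<nat>" by (auto elim!: Nats_cases simp flip: of_nat_diff)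
next
  fix x :: real assume "x \<in> \<nat>"
  then show "0 \<le> x" by (auto elim: Nats_cases)
qed auto

lemma weight_domainD:
  assumes "weight_domain A"
  shows "0 \<in> A" "x \<in> A \<Longrightarrow> 0 \<le> x" "x \<in> A \<Longrightarrow> y \<in> A \<Longrightarrow> x + y \<in> A"
    "x \<in> A \<Longrightarrow> y \<in> A \<Longrightarrow> y \<le> x \<Longrightarrow> x - y \<in> A"
  using assms by (auto simp: weight_domain_def)

lemma weight_domain_sum:
  assumes "weight_domain A" "\<And>S. S \<in> F \<Longrightarrow> c S \<in> A"
  shows "sum c F \<in> A"
  using assms(2) by (induction F rule: infinite_finite_induct) (auto intro: weight_domainD[OF assms(1)])

lemma weight_domain_load:
  assumes "weight_domain A" "\<And>S. S \<in> F \<Longrightarrow> c S \<in> A"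
  shows "load F c i \<in> A"
  unfolding load_def using assms
  by (intro weight_domain_sum) (auto simp: of_bool_def weight_domainD(1))

lemma load_add: "load F (\<lambda>S. c S + d S) i = load F c i + load F d i"
  by (simp add: load_def algebra_simps sum.distrib)

lemma load_extend:
  assumes "finite F" "E \<subseteq> F"
  shows "load F (\<lambda>S. if S \<in> E then c S else 0) i = load E c i"
    and "(\<Sum>S\<in>F. if S \<in> E then c S else 0) = sum c E"
  unfolding load_def by (rule sum.mono_neutral_cong_right; use assms in auto)+

lemma load_le_total:
  assumes "\<And>S. S \<in> F \<Longrightarrow> 0 \<le> c S"
  shows "load F c i \<le> sum c F"
  unfolding load_def using assms by (intro sum_mono) (auto simp: of_bool_def)

text \<open>Serve the members of \<open>T\<close> greedily: each contributes its whole weight until \<open>D\<close> is used up. No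
  division occurs, so the argument also works for natural weights.\<close>

lemma split_total:
  assumes A: "weight_domain A" and "finite T" "\<And>S. S \<in> T \<Longrightarrow> c S \<in> A" "D \<in> A" "D \<le> sum c T"
  shows "\<exists>d. (\<forall>S\<in>T. d S \<in> A \<and> d S \<le> c S) \<and> sum d T = D"
  using assms(2-5)
proof (induction T arbitrary: D rule: finite_induct)
  case empty
  then show ?case using weight_domainD(2)[OF A] by force
next
  case (insert S T)
  have cT: "sum c T \<in> A" using insert.prems(1) by (intro weight_domain_sum[OF A]) auto
  show ?case
  proof (cases "D \<le> sum c T")
    case True
    then obtain d where d: "\<forall>S\<in>T. d S \<in> A \<and> d S \<le> c S" "sum d T = D"
      using insert by (metis insertCI)
    have "sum (d(S := 0)) T = sum d T" using insert.hyps by (intro sum.cong) auto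
    then show ?thesis
      using d insert.hyps weight_domainD(1)[OF A] weight_domainD(2)[OF A] insert.prems(1)
      by (intro exI[of _ "d(S := 0)"]) auto
  next
    case False
    have "sum (c(S := D - sum c T)) T = sum c T" using insert.hyps by (intro sum.cong) auto
    then show ?thesis
      using False insert.hyps insert.prems weight_domainD(4)[OF A insert.prems(2) cT]
      by (intro exI[of _ "c(S := D - sum c T)"]) auto
  qed
qed

text \<open>To lower the load of \<open>i\<close> alone, move part of the weight of each \<open>S\<close> containing \<open>i\<close> to
  \<open>S - {i}\<close>. This changes neither the total nor any other load.\<close>

lemma lower_load:
  assumes A: "weight_domain A" and F: "finite F" "\<And>S. S \<in> F \<Longrightarrow> S - {i} \<in> F"
    and c: "\<And>S. S \<in> F \<Longrightarrow> c S \<in> A" and b: "b \<in> A" "b \<le> load F c i"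
  obtains c' where "\<And>S. S \<in> F \<Longrightarrow> c' S \<in> A" "sum c' F = sum c F" "load F c' i = b"
    "\<And>j. j \<noteq> i \<Longrightarrow> load F c' j = load F c j"
proof -
  define T where "T = {S \<in> F. i \<in> S}"
  have finT: "finite T" using F(1) by (simp add: T_def)
  have T: "load F k i = sum k T" for k
    unfolding load_def by (rule sum.mono_neutral_cong_right) (use F(1) in \<open>auto simp: T_def\<close>)
  have "load F c i \<in> A" using weight_domain_load[OF A] c by metis
  then have "load F c i - b \<in> A" using weight_domainD(4)[OF A] b by metis
  then obtain d where d: "\<forall>S\<in>T. d S \<in> A \<and> d S \<le> c S" "sum d T = load F c i - b"
    using split_total[OF A finT, of c "load F c i - b"] c weight_domainD(2)[OF A b(1)] T[of c]
    by (metis (no_types, lifting) T_def diff_le_eq le_add_same_cancel1 mem_Collect_eq)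
  \<comment> \<open>The change of the weight of \<open>S\<close>: a loss \<open>d S\<close> if \<open>i \<in> S\<close>, otherwise the gain from \<open>insert i S\<close>.\<close>
  define e where "e S = (if i \<in> S then - d S else if insert i S \<in> F then d (insert i S) else 0)" for S
  define c' where "c' S = c S + e S" for S
  \<comment> \<open>Any sum that does not see whether \<open>i\<close> belongs to \<open>S\<close> is unchanged; this gives both the
      total and the loads of the other vertices.\<close>
  have inv: "(\<Sum>S\<in>F. g S * c' S) = (\<Sum>S\<in>F. g S * c S)"
    if g: "\<And>S. g (insert i S) = g S" for g :: "'a set \<Rightarrow> real"
  proof -
    let ?R = "{S \<in> F. i \<notin> S \<and> insert i S \<in> F}"
    have "(\<Sum>S\<in>F. g S * e S) = (\<Sum>S\<in>T. g S * e S) + (\<Sum>S\<in>F - T. g S * e S)"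
      using F(1) by (subst sum.subset_diff[of T F]) (auto simp: T_def)
    also have "(\<Sum>S\<in>T. g S * e S) = - (\<Sum>S\<in>T. g S * d S)"
      by (simp add: sum_negf[symmetric] T_def e_def)
    also have "(\<Sum>S\<in>F - T. g S * e S) = (\<Sum>S\<in>?R. g S * d (insert i S))"
      using F(1) by (intro sum.mono_neutral_cong_right) (auto simp: T_def e_def)
    also have "\<dots> = (\<Sum>S\<in>T. g S * d S)"
      by (rule sum.reindex_bij_witness[of _ "\<lambda>S. S - {i}" "insert i"])
         (auto simp: T_def insert_absorb g F(2))
    finally show ?thesis by (simp add: c'_def algebra_simps sum.distrib)
  qed
  show thesis
  proof
    show "c' S \<in> A" if S: "S \<in> F" for S
    proof (cases "i \<in> S")
      case True
      then show ?thesis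
        using d(1) S weight_domainD(4)[OF A c[OF S], of "d S"] by (auto simp: c'_def e_def T_def)
    next
      case False
      then show ?thesis
        using d(1) S c[OF S] weight_domainD(3)[OF A c[OF S], of "d (insert i S)"]
        by (auto simp: c'_def e_def T_def)
    qed
    show "sum c' F = sum c F" using inv[of "\<lambda>_. 1"] by simp
    have "sum c' T = sum c T - sum d T"
      by (simp add: c'_def e_def T_def sum_subtractf[symmetric])
    then show "load F c' i = b" using d(2) by (simp add: T)
    show "load F c' j = load F c j" if "j \<noteq> i" for j
      unfolding load_def using that by (intro inv) auto
  qed
qed

text \<open>In a family closed under deleting vertices the excess of a cover can be shed one vertex after
  another.\<close>

lemma covers_imp_represents:
  fixes F :: "'v::finite set set"
  assumes A: "weight_domain A" and F: "\<And>S i. S \<in> F \<Longrightarrow> S - {i} \<in> F"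
    and x: "covers A F x y" "\<And>i. x i \<in> A"
  shows "represents A F x y"
proof -
  obtain c where c: "\<forall>S\<in>F. c S \<in> A" "sum c F = y" "\<forall>i. x i \<le> load F c i"
    using x(1) by (auto simp: covers_def)
  have "finite X \<Longrightarrow> \<exists>c'. (\<forall>S\<in>F. c' S \<in> A) \<and> sum c' F = y
      \<and> (\<forall>i. load F c' i = (if i \<in> X then x i else load F c i))" for X
  proof (induction X rule: finite_induct)
    case empty
    then show ?case using c by auto
  next
    case (insert i X)
    then obtain c1 where c1: "\<forall>S\<in>F. c1 S \<in> A" "sum c1 F = y"
      "\<forall>i. load F c1 i = (if i \<in> X then x i else load F c i)" by blast
    have "x i \<le> load F c1 i" using c1(3) insert.hyps c(3) by auto
    then obtain c2 where "\<And>S. S \<in> F \<Longrightarrow> c2 S \<in> A" "sum c2 F = sum c1 F" "load F c2 i = x i"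
      "\<And>j. j \<noteq> i \<Longrightarrow> load F c2 j = load F c1 j"
      using lower_load[OF A, where F = F and i = i and c = c1 and b = "x i"] c1(1) x(2) F
      by (metis finite_code)
    moreover have "load F c2 j = (if j \<in> insert i X then x j else load F c j)" for j
      using calculation(3,4) c1(3) by (cases "j = i") auto
    ultimately show ?case using c1(2) by (intro exI[of _ c2]) auto
  qed
  from this[of UNIV] show ?thesis by (auto simp: represents_def)
qed

text \<open>Moving the weight of each set to a member of \<open>E\<close> that contains it only increases loads.\<close>

lemma covers_by_larger_sets:
  fixes E F :: "'v::finite set set"
  assumes A: "weight_domain A" and E: "E \<noteq> {}" and c: "\<And>S. S \<in> F \<Longrightarrow> c S \<in> A"
    and sub: "\<And>S. S \<in> F \<Longrightarrow> c S \<noteq> 0 \<Longrightarrow> \<exists>e\<in>E. S \<subseteq> e"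
  shows "covers A E (load F c) (sum c F)"
proof -
  define h where "h S = (if \<exists>e\<in>E. S \<subseteq> e then SOME e. e \<in> E \<and> S \<subseteq> e else SOME e. e \<in> E)" for S
  have h1: "h S \<in> E \<and> S \<subseteq> h S" if "\<exists>e\<in>E. S \<subseteq> e" for S
    using someI_ex[of "\<lambda>e. e \<in> E \<and> S \<subseteq> e"] that by (auto simp: h_def)
  have h2: "h S \<in> E" for S
    using h1[of S] someI_ex[of "\<lambda>e. e \<in> E"] E by (cases "\<exists>e\<in>E. S \<subseteq> e") (auto simp: h_def)
  define d where "d e = (\<Sum>S | S \<in> F \<and> h S = e. c S)" for e
  have "d e \<in> A" for e unfolding d_def by (rule weight_domain_sum[OF A]) (auto simp: c)
  moreover have "sum d E = sum c F"
    unfolding d_def by (rule sum.group) (use h2 in auto)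
  moreover have "load F c i \<le> load E d i" for i
  proof -
    have "load E d i = (\<Sum>e\<in>E. \<Sum>S | S \<in> F \<and> h S = e. of_bool (i \<in> h S) * c S)"
      by (auto simp: load_def d_def sum_distrib_left intro!: sum.cong)
    also have "\<dots> = (\<Sum>S\<in>F. of_bool (i \<in> h S) * c S)"
      by (rule sum.group) (use h2 in auto)
    finally have *: "load E d i = (\<Sum>S\<in>F. of_bool (i \<in> h S) * c S)" .
    have "of_bool (i \<in> S) * c S \<le> of_bool (i \<in> h S) * c S" if "S \<in> F" for S
    proof (cases "c S = 0")
      case False
      then show ?thesis using h1 sub[OF that] weight_domainD(2)[OF A c[OF that]]
        by (auto simp: of_bool_def)
    qed simp
    then have "load F c i \<le> (\<Sum>S\<in>F. of_bool (i \<in> h S) * c S)"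
      unfolding load_def by (rule sum_mono)
    then show ?thesis unfolding * .
  qed
  ultimately show ?thesis by (auto simp: covers_def)
qed

section \<open>Edges against faces of the graph\<close>

text \<open>The graph as a simplicial complex. Its faces index the vectors of \<open>basis_set\<close>: the empty face
  gives \<open>e\<^sub>s\<^sub>+\<^sub>1\<close>, a vertex gives \<open>e\<^sub>i + e\<^sub>s\<^sub>+\<^sub>1\<close>, and an edge gives \<open>(v\<^sub>i, 1)\<close>.\<close>

definition graph_complex :: "'v set set \<Rightarrow> 'v set set" where
  "graph_complex E = insert {} (range (\<lambda>i. {i}) \<union> E)"

lemma graph_complex_diff:
  assumes "\<forall>e\<in>E. card e = 2" "S \<in> graph_complex E"
  shows "S - {i} \<in> graph_complex E"
proof (cases "S \<in> E \<and> i \<in> S")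
  case True
  then have "card (S - {i}) = 1" using assms(1) by simp
  then show ?thesis by (auto simp: graph_complex_def card_1_singleton_iff)
next
  case False
  then show ?thesis using assms(2) by (cases "i \<in> S") (auto simp: graph_complex_def)
qed

text \<open>The inequality \<open>n - a i \<le> load E c i\<close> says that \<open>t\<^sup>a\<close> is divisible by the product of the
  generators of the dual ideal with multiplicities \<open>c\<close> of total \<open>n\<close>: the generator of \<open>e\<close> has
  exponent \<open>1 - of_bool (i \<in> e)\<close> at \<open>i\<close>, so that the product has exponent \<open>n - load E c i\<close>.\<close>

definition edge_decomposition :: "'v set set \<Rightarrow> bool" where
  "edge_decomposition E \<longleftrightarrow> (\<forall>n\<ge>1. \<forall>a :: 'v \<Rightarrow> nat.
     covers {0..} E (\<lambda>i. real n - real (a i)) (real n)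
       \<longrightarrow> covers \<nat> E (\<lambda>i. real n - real (a i)) (real n))"

text \<open>The Hilbert basis property of the vectors \<open>(indicator of S, 1)\<close>, \<open>S \<in> F\<close>, in terms of
  weights.\<close>

definition integer_decomposition :: "'v set set \<Rightarrow> bool" where
  "integer_decomposition F \<longleftrightarrow> (\<forall>x y. (\<forall>i. x i \<in> \<int>) \<and> y \<in> \<int> \<and> represents {0..} F x y
     \<longrightarrow> represents \<nat> F x y)"

text \<open>A real cover of the positive part of \<open>n - a\<close> by edges is shed to an exact representation by
  faces, which can be chosen integral, and the faces are then enlarged to edges again. Every face
  that is used lies in an edge, because the load of a vertex on no edge is \<open>0\<close>.\<close>

lemma edge_decomposition_if_integer:
  fixes E :: "'v::finite set set"
  assumes E: "\<forall>e\<in>E. card e = 2" and F: "integer_decomposition (graph_complex E)"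
  shows "edge_decomposition E"
  unfolding edge_decomposition_def
proof (intro allI impI)
  fix n :: nat and a :: "'v \<Rightarrow> nat"
  assume n: "1 \<le> n" and "covers {0..} E (\<lambda>i. real n - real (a i)) (real n)"
  then obtain c where c: "\<forall>e\<in>E. (0 :: real) \<le> c e" "sum c E = n" "\<forall>i. real n - real (a i) \<le> load E c i"
    by (auto simp: covers_def)
  let ?F = "graph_complex E"
  have EF: "E \<subseteq> ?F" by (auto simp: graph_complex_def)
  \<comment> \<open>Truncated subtraction: \<open>b\<close> is the positive part of \<open>n - a\<close>.\<close>
  define b where "b i = real (n - a i)" for i
  have load0: "0 \<le> load E c i" for i
    using weight_domain_load[OF weight_domain_nonneg, of E c i] c(1) by auto
  have b: "real n - real (a i) \<le> b i" "b i \<le> load E c i" for i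
    using c(3)[rule_format, of i] load0[of i] by (auto simp: b_def)
  have "covers {0..} ?F b n"
    unfolding covers_def using c b load_extend[OF _ EF, of c]
    by (intro exI[of _ "\<lambda>S. if S \<in> E then c S else 0"]) auto
  then have "represents {0..} ?F b n"
    by (intro covers_imp_represents[OF weight_domain_nonneg] graph_complex_diff[OF E])
       (auto simp: b_def)
  then have "represents \<nat> ?F b n"
    using F[unfolded integer_decomposition_def, rule_format, of b n] by (auto simp: b_def)
  then obtain d where d: "\<And>S. S \<in> ?F \<Longrightarrow> d S \<in> \<nat>" "sum d ?F = real n" "\<And>i. load ?F d i = b i"
    by (auto simp: represents_def)
  have E0: "E \<noteq> {}" using c(2) n by auto
  have "\<exists>e\<in>E. S \<subseteq> e" if S: "S \<in> ?F" "d S \<noteq> 0" for S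
  proof (rule ccontr)
    assume no: "\<not> (\<exists>e\<in>E. S \<subseteq> e)"
    then obtain i where i: "S = {i}" using S(1) E0 by (auto simp: graph_complex_def)
    then have "load E c i = 0" using no by (auto simp: load_def)
    then have "load ?F d i = 0" using b(2)[of i] d(3)[of i] by (simp add: b_def)
    moreover have "\<forall>S\<in>?F. 0 \<le> of_bool (i \<in> S) * d S" using d(1) Nats_altdef2 by fastforce
    ultimately have "of_bool (i \<in> S) * d S = 0"
      unfolding load_def using S(1) by (subst (asm) sum_nonneg_eq_0_iff) auto
    then show False using S(2) i by simp
  qed
  then have "covers \<nat> E (load ?F d) (sum d ?F)"
    by (intro covers_by_larger_sets[OF weight_domain_Nats E0]) (auto simp: d)
  then show "covers \<nat> E (\<lambda>i. real n - real (a i)) (real n)"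
    unfolding covers_def d(2,3) using b(1) order_trans by blast
qed

text \<open>The same passage in the opposite direction. A vertex \<open>i\<close> on no edge is contained only in the
  face \<open>{i}\<close>, so in any representation of \<open>x\<close> this face has the integral weight \<open>x i\<close>. After
  splitting off these weights every face that still has weight can be enlarged to an edge, except
  in a graph without edges, where only the empty face remains.\<close>

lemma integer_decomposition_if_edge:
  fixes E :: "'v::finite set set"
  assumes E: "\<forall>e\<in>E. card e = 2" and P: "edge_decomposition E"
  shows "integer_decomposition (graph_complex E)"
  unfolding integer_decomposition_def
proof (intro allI impI, elim conjE)
  fix x :: "'v \<Rightarrow> real" and y :: real
  let ?F = "graph_complex E"
  assume int: "\<forall>i. x i \<in> \<int>" "y \<in> \<int>" and "represents {0..} ?F x y"
  then obtain c where c: "\<And>S. S \<in> ?F \<Longrightarrow> 0 \<le> c S" "sum c ?F = y" "\<And>i. load ?F c i = x i"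
    by (auto simp: represents_def)
  have EF: "E \<subseteq> ?F" by (auto simp: graph_complex_def)
  \<comment> \<open>The isolated vertices; \<open>c1\<close> is the part of \<open>c\<close> that sits on them.\<close>
  define I where "I = - \<Union>E"
  define c1 where "c1 S = (if S \<in> (\<lambda>i. {i}) ` I then c S else 0)" for S
  define c0 where "c0 S = c S - c1 S" for S
  have IF: "(\<lambda>i. {i}) ` I \<subseteq> ?F" by (auto simp: graph_complex_def)
  have iso: "S = {i}" if "i \<in> I" "S \<in> ?F" "i \<in> S" for i S
    using that by (auto simp: I_def graph_complex_def)
  have load_iso: "load ?F k i = k {i}" if "i \<in> I" for k i
  proof -
    have "load ?F k i = (\<Sum>S\<in>{{i}}. of_bool (i \<in> S) * k S)"
      unfolding load_def using iso[OF that] IF that by (intro sum.mono_neutral_right) auto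
    then show ?thesis by simp
  qed
  have x0: "0 \<le> x i" for i
    using weight_domain_load[OF weight_domain_nonneg, of ?F c i] c by auto
  have natx: "x i \<in> \<nat>" for i using int(1) x0[of i] by (simp add: Nats_altdef2)
  have "c {i} \<in> \<nat>" if "i \<in> I" for i
    using natx[of i] load_iso[OF that, of c] c(3)[of i] by simp
  then have c1N: "c1 S \<in> \<nat>" for S by (auto simp: c1_def)
  have load1: "load ?F c1 i = (if i \<in> I then x i else 0)" for i
  proof (cases "i \<in> I")
    case True
    then show ?thesis using load_iso[OF True, of c1] load_iso[OF True, of c] c(3)[of i]
      by (simp add: c1_def)
  next
    case False
    then show ?thesis by (auto simp: load_def c1_def intro!: sum.neutral)
  qed
  have load0: "load ?F c0 i = (if i \<in> I then 0 else x i)" for i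
    using load_add[of ?F c0 c1 i] load1[of i] c(3)[of i] by (auto simp: c0_def)
  have c0: "0 \<le> c0 S" if "S \<in> ?F" for S using c(1)[OF that] by (simp add: c0_def c1_def)
  have "sum c0 ?F = y - sum c1 ?F" using c(2) by (simp add: c0_def sum_subtractf)
  moreover have "sum c1 ?F \<in> \<nat>" by (rule weight_domain_sum[OF weight_domain_Nats c1N])
  ultimately have "sum c0 ?F \<in> \<nat>"
    using int(2) sum_nonneg[of ?F c0] c0 by (simp add: Nats_altdef2)
  then obtain n where n: "sum c0 ?F = real n" by (auto elim: Nats_cases)
  define b where "b i = (if i \<in> I then 0 else x i)" for i
  have bN: "b i \<in> \<nat>" for i using natx by (simp add: b_def)
  have "represents \<nat> ?F b n"
  proof (cases "E = {} \<or> n = 0")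
    case True
    then have b0: "b i = 0" for i
    proof
      assume "E = {}" then show ?thesis by (simp add: b_def I_def)
    next
      assume "n = 0"
      then show ?thesis
        using load_le_total[of ?F c0 i] c0 n load0[of i] x0[of i] by (auto simp: b_def)
    qed
    \<comment> \<open>Nothing but the total is left, and the empty face carries it.\<close>
    have "(\<Sum>S\<in>?F. if S \<in> {{}} then real n else 0) = (\<Sum>S\<in>{{}}. real n)"
      using load_extend(2)[of ?F "{{}}" "\<lambda>_. real n"] by (simp add: graph_complex_def)
    moreover have "load ?F (\<lambda>S. if S \<in> {{}} then real n else 0) i = 0" for i
      by (auto simp: load_def intro!: sum.neutral)
    ultimately show ?thesis
      unfolding represents_def by (intro exI[of _ "\<lambda>S. if S \<in> {{}} then real n else 0"]) (auto simp: b0)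
  next
    case False
    have "\<exists>e\<in>E. S \<subseteq> e" if "S \<in> ?F" "c0 S \<noteq> 0" for S
      using that False by (auto simp: graph_complex_def c0_def c1_def I_def)
    then have "covers {0..} E (load ?F c0) (sum c0 ?F)"
      using False c0 by (intro covers_by_larger_sets[OF weight_domain_nonneg]) auto
    moreover have "load ?F c0 = b" by (simp add: fun_eq_iff load0 b_def)
    ultimately have cov: "covers {0..} E b n" by (simp add: n)
    \<comment> \<open>The exponent for which the edge property speaks about \<open>b\<close>; a load never exceeds
        the total, so \<open>n - b i\<close> is natural.\<close>
    define a where "a i = nat \<lfloor>real n - b i\<rfloor>" for i
    have a: "real n - real (a i) = b i" for i
    proof -
      have "b i \<le> real n"
        using load_le_total[of ?F c0 i] c0 n load0[of i] by (auto simp: b_def)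
      moreover obtain m where "b i = real m" using bN by (auto elim: Nats_cases)
      ultimately show ?thesis by (simp add: a_def)
    qed
    have "covers \<nat> E b n"
      using P[unfolded edge_decomposition_def, rule_format, of n a] cov False by (simp add: a)
    then obtain d where d: "\<forall>e\<in>E. d e \<in> \<nat>" "sum d E = real n" "\<forall>i. b i \<le> load E d i"
      by (auto simp: covers_def)
    have "covers \<nat> ?F b n"
      unfolding covers_def using d load_extend[OF _ EF, of d]
      by (intro exI[of _ "\<lambda>S. if S \<in> E then d S else 0"]) auto
    then show ?thesis
      by (intro covers_imp_represents[OF weight_domain_Nats] graph_complex_diff[OF E]) (auto simp: bN)
  qed
  then obtain d where d: "\<And>S. S \<in> ?F \<Longrightarrow> d S \<in> \<nat>" "sum d ?F = real n" "\<And>i. load ?F d i = b i"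
    by (auto simp: represents_def)
  have "sum d ?F + sum c1 ?F = y" using d(2) n c(2) by (simp add: c0_def sum_subtractf)
  moreover have "load ?F d i + load ?F c1 i = x i" for i by (simp add: d(3) load1 b_def)
  ultimately show "represents \<nat> ?F x y"
    unfolding represents_def using d(1) c1N
    by (intro exI[of _ "\<lambda>S. d S + c1 S"]) (auto simp: load_add sum.distrib)
qed

section \<open>Cones and semigroups of indicator vectors\<close>

definition indicator_vec :: "'v::finite set \<Rightarrow> real ^ 'v" where
  "indicator_vec S = (\<chi> i. of_bool (i \<in> S))"

lemma indicator_vec_inject: "indicator_vec S = indicator_vec T \<longleftrightarrow> S = T"
  by (auto simp: indicator_vec_def vec_eq_iff of_bool_def split: if_splits)

text \<open>Indicator vectors of different sets are different, so weights on the vectors and weights on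
  the sets are the same thing. The last coordinate of each vector is \<open>1\<close> and records the total.\<close>

lemma weighted_sums_eq_represents:
  fixes F :: "'v::finite set set"
  shows "{\<Sum>b\<in>(\<lambda>S. (indicator_vec S, 1::real)) ` F. c b *\<^sub>R b |c. \<forall>b\<in>(\<lambda>S. (indicator_vec S, 1)) ` F. c b \<in> A}
    = {(x, y). represents A F (($) x) y}"
proof -
  let ?g = "\<lambda>S. (indicator_vec S :: real ^ 'v, 1::real)"
  have inj: "inj_on ?g F" by (auto simp: inj_on_def indicator_vec_inject)
  have eq: "(\<Sum>b\<in>?g ` F. c b *\<^sub>R b) = (\<chi> i. load F (c \<circ> ?g) i, sum (c \<circ> ?g) F)" for c
  proof -
    have "(\<Sum>b\<in>?g ` F. c b *\<^sub>R b) = (\<Sum>S\<in>F. c (?g S) *\<^sub>R ?g S)"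
      using sum.reindex[OF inj, of "\<lambda>b. c b *\<^sub>R b"] by (simp only: o_def)
    also have "\<dots> = (\<chi> i. load F (c \<circ> ?g) i, sum (c \<circ> ?g) F)"
      by (simp add: prod_eq_iff fst_sum snd_sum vec_eq_iff load_def indicator_vec_def mult.commute)
    finally show ?thesis .
  qed
  show ?thesis
  proof (intro equalityI subsetI; clarsimp simp only: eq)
    fix c assume "\<forall>b\<in>?g ` F. c b \<in> A"
    then show "represents A F (($) (\<chi> i. load F (c \<circ> ?g) i)) (sum (c \<circ> ?g) F)"
      unfolding represents_def by (intro exI[of _ "c \<circ> ?g"]) auto
  next
    fix x y assume "represents A F (($) x) y"
    then obtain c where c: "\<forall>S\<in>F. c S \<in> A" "sum c F = y" "\<forall>i. load F c i = x $ i"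
      by (auto simp: represents_def)
    define c' where "c' = c \<circ> inv_into F ?g"
    have c': "(c' \<circ> ?g) S = c S" if "S \<in> F" for S
      using inv_into_f_f[OF inj that] by (simp add: c'_def)
    have "load F (c' \<circ> ?g) i = load F c i" for i
      unfolding load_def using c' by (intro sum.cong) auto
    moreover have "sum (c' \<circ> ?g) F = sum c F" using c' by (intro sum.cong) auto
    ultimately show "\<exists>c. (x, y) = (\<chi> i. load F (c \<circ> ?g) i, sum (c \<circ> ?g) F) \<and> (\<forall>b\<in>?g ` F. c b \<in> A)"
      using c c' by (intro exI[of _ c']) (auto simp: vec_eq_iff)
  qed
qed

lemma integer_points_iff:
  fixes x :: "real ^ 'v"
  shows "(x, y) \<in> (integer_points :: ((real ^ 'v) \<times> real) set) \<longleftrightarrow> (\<forall>i. x $ i \<in> \<int>) \<and> y \<in> \<int>"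
  by (auto simp: integer_points_def Basis_prod_def Basis_vec_def inner_axis)

lemma hilbert_basis_iff_integer_decomposition:
  fixes F :: "'v::finite set set"
  shows "hilbert_basis ((\<lambda>S. (indicator_vec S, 1 :: real)) ` F) \<longleftrightarrow> integer_decomposition F"
proof -
  let ?B = "(\<lambda>S. (indicator_vec S :: real ^ 'v, 1::real)) ` F"
  have cone: "real_cone ?B = {(x, y). represents {0..} F (($) x) y}"
    using weighted_sums_eq_represents[of F "{0..}"] by (simp add: real_cone_def)
  have "nat_semigroup ?B = {\<Sum>b\<in>?B. c b *\<^sub>R b |c. \<forall>b\<in>?B. c b \<in> \<nat>}"
  proof (intro equalityI subsetI)
    fix z assume "z \<in> {\<Sum>b\<in>?B. c b *\<^sub>R b |c. \<forall>b\<in>?B. c b \<in> \<nat>}"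
    then obtain c where c: "z = (\<Sum>b\<in>?B. c b *\<^sub>R b)" "\<forall>b\<in>?B. c b \<in> \<nat>" by auto
    have "real (nat \<lfloor>c b\<rfloor>) = c b" if "b \<in> ?B" for b
      using c(2)[rule_format, OF that] by (auto elim!: Nats_cases)
    then have "z = (\<Sum>b\<in>?B. real (nat \<lfloor>c b\<rfloor>) *\<^sub>R b)" unfolding c(1) by (intro sum.cong) auto
    then show "z \<in> nat_semigroup ?B"
      unfolding nat_semigroup_def by (intro CollectI exI[of _ "\<lambda>b. nat \<lfloor>c b\<rfloor>"]) auto
  next
    fix z assume "z \<in> nat_semigroup ?B"
    then obtain n where "z = (\<Sum>b\<in>?B. real (n b) *\<^sub>R b)" by (auto simp: nat_semigroup_def)
    then show "z \<in> {\<Sum>b\<in>?B. c b *\<^sub>R b |c. \<forall>b\<in>?B. c b \<in> \<nat>}"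
      by (intro CollectI exI[of _ "\<lambda>b. real (n b)"]) auto
  qed
  then have semi: "nat_semigroup ?B = {(x, y). represents \<nat> F (($) x) y}"
    using weighted_sums_eq_represents[of F \<nat>] by simp
  have sub: "(\<forall>i. x i \<in> \<int>) \<and> y \<in> \<int> \<and> represents {0..} F x y" if r: "represents \<nat> F x y" for x y
  proof -
    obtain c where c: "\<forall>S\<in>F. c S \<in> \<nat>" "sum c F = y" "\<forall>i. load F c i = x i"
      using r by (auto simp: represents_def)
    have "x i \<in> \<nat>" for i using weight_domain_load[OF weight_domain_Nats, of F c i] c by auto
    moreover have "y \<in> \<nat>" using weight_domain_sum[OF weight_domain_Nats, of F c] c by auto
    moreover have "\<forall>S\<in>F. c S \<in> {0..}" using c(1) by (auto simp: Nats_altdef2)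
    ultimately show ?thesis using c by (auto simp: represents_def Nats_altdef2)
  qed
  have "nat_semigroup ?B \<subseteq> integer_points \<inter> real_cone ?B"
  proof
    fix z assume "z \<in> nat_semigroup ?B"
    then show "z \<in> integer_points \<inter> real_cone ?B"
      using sub[of "($) (fst z)" "snd z"] integer_points_iff[of "fst z" "snd z"]
      by (simp add: cone semi case_prod_unfold)
  qed
  then have "hilbert_basis ?B \<longleftrightarrow> integer_points \<inter> real_cone ?B \<subseteq> nat_semigroup ?B"
    by (auto simp: hilbert_basis_def)
  also have "\<dots> \<longleftrightarrow> (\<forall>(x :: real ^ 'v) y. (\<forall>i. x $ i \<in> \<int>) \<and> y \<in> \<int> \<and> represents {0..} F (($) x) y
     \<longrightarrow> represents \<nat> F (($) x) y)"
    unfolding cone semi by (simp add: subset_iff integer_points_iff)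
  also have "\<dots> \<longleftrightarrow> integer_decomposition F"
    unfolding integer_decomposition_def
  proof (intro iffI allI impI)
    fix x y assume "\<forall>(x :: real ^ 'v) y. (\<forall>i. x $ i \<in> \<int>) \<and> y \<in> \<int> \<and> represents {0..} F (($) x) y
     \<longrightarrow> represents \<nat> F (($) x) y" and "(\<forall>i. x i \<in> \<int>) \<and> y \<in> \<int> \<and> represents {0..} F x y"
    moreover have "($) (\<chi> i. x i) = x" by (simp add: fun_eq_iff)
    ultimately show "represents \<nat> F x y" by (metis (no_types))
  qed blast
  finally show ?thesis .
qed

section \<open>Normality of the dual edge ideal\<close>

definition set_exp :: "'v::finite set \<Rightarrow> 'v \<Rightarrow>\<^sub>0 nat" where
  "set_exp S = (\<Sum>i\<in>S. Poly_Mapping.single i 1)"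

lemma lookup_sum_singles:
  fixes k :: "'v::finite \<Rightarrow> 'a::comm_monoid_add"
  shows "Poly_Mapping.lookup (\<Sum>i\<in>S. Poly_Mapping.single i (k i)) j = (if j \<in> S then k j else 0)"
  by (simp add: lookup_sum lookup_single when_def)

lemma lookup_set_exp: "Poly_Mapping.lookup (set_exp S) i = of_bool (i \<in> S)"
  unfolding set_exp_def by (subst lookup_sum_singles) simp

lemma prod_var_powers:
  "(\<Prod>i\<in>S. var i ^ k i) = (Poly_Mapping.single (\<Sum>i\<in>S. Poly_Mapping.single i (k i)) 1 :: ('v::finite, 'k::field) polyring)"
proof (induction S rule: infinite_finite_induct)
  case (insert i S)
  have "var i ^ n = (Poly_Mapping.single (Poly_Mapping.single i n) 1 :: ('v, 'k) polyring)" for n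
    by (induction n) (simp_all add: var_def mult_single single_add[symmetric])
  then show ?case using insert by (simp add: mult_single)
qed simp_all

lemma prod_vars:
  "(\<Prod>i\<in>S. var i) = (Poly_Mapping.single (set_exp S) 1 :: ('v::finite, 'k::field) polyring)"
  using prod_var_powers[of "\<lambda>_. 1" S] by (simp add: set_exp_def)

lemma exp_split_iff:
  fixes w a :: "'v \<Rightarrow>\<^sub>0 nat"
  shows "(\<exists>c. a = w + c) \<longleftrightarrow> (\<forall>i. Poly_Mapping.lookup w i \<le> Poly_Mapping.lookup a i)"
proof
  assume "\<forall>i. Poly_Mapping.lookup w i \<le> Poly_Mapping.lookup a i"
  then have "a = w + (a - w)" by (intro poly_mapping_eqI) (simp add: lookup_add lookup_minus)
  then show "\<exists>c. a = w + c" ..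
qed (auto simp: lookup_add)

text \<open>A vector of multiplicities replaces the order in which generators are multiplied; the
  inequality accounts for the multiples of such a product.\<close>

lemma power_exps_iff_sums:
  fixes w :: "'e::finite \<Rightarrow> 'v \<Rightarrow>\<^sub>0 nat"
  shows "a \<in> power_exps (w ` E) n \<longleftrightarrow>
    (\<exists>k. sum k E = n \<and> (\<forall>i. (\<Sum>e\<in>E. k e * Poly_Mapping.lookup (w e) i) \<le> Poly_Mapping.lookup a i))"
proof (induction n arbitrary: a)
  case 0
  show ?case by (auto intro!: exI[of _ "\<lambda>_. 0"])
next
  case (Suc n)
  show ?case
  proof
    assume "a \<in> power_exps (w ` E) (Suc n)"
    then obtain e b where e: "e \<in> E" "a = w e + b" "b \<in> power_exps (w ` E) n" by auto
    then obtain k where k: "sum k E = n"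
      "\<And>i. (\<Sum>e\<in>E. k e * Poly_Mapping.lookup (w e) i) \<le> Poly_Mapping.lookup b i"
      using Suc by blast
    have upd: "(\<Sum>x\<in>E. (k x + of_bool (x = e)) * g x) = (\<Sum>x\<in>E. k x * g x) + g e" for g :: "'e \<Rightarrow> nat"
    proof -
      have "(\<Sum>x\<in>E. of_bool (x = e) * g x) = (\<Sum>x\<in>E. if x = e then g x else 0)"
        by (intro sum.cong) auto
      also have "\<dots> = g e" using e(1) by simp
      finally show ?thesis by (simp only: distrib_right sum.distrib)
    qed
    show "\<exists>k. sum k E = Suc n \<and> (\<forall>i. (\<Sum>e\<in>E. k e * Poly_Mapping.lookup (w e) i) \<le> Poly_Mapping.lookup a i)"
    proof (intro exI[of _ "\<lambda>x. k x + of_bool (x = e)"] conjI allI)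
      show "(\<Sum>x\<in>E. k x + of_bool (x = e)) = Suc n" using upd[of "\<lambda>_. 1"] k(1) by simp
      show "(\<Sum>x\<in>E. (k x + of_bool (x = e)) * Poly_Mapping.lookup (w x) i) \<le> Poly_Mapping.lookup a i" for i
        unfolding upd using k(2)[of i] by (simp add: e(2) lookup_add)
    qed
  next
    assume "\<exists>k. sum k E = Suc n \<and> (\<forall>i. (\<Sum>e\<in>E. k e * Poly_Mapping.lookup (w e) i) \<le> Poly_Mapping.lookup a i)"
    then obtain k where k: "sum k E = Suc n"
      "\<And>i. (\<Sum>e\<in>E. k e * Poly_Mapping.lookup (w e) i) \<le> Poly_Mapping.lookup a i" by blast
    obtain e where e: "e \<in> E" "k e \<noteq> 0" using k(1) by (metis nat.distinct(1) sum.neutral)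
    define k' where "k' = k(e := k e - 1)"
    have upd: "(\<Sum>x\<in>E. k x * g x) = (\<Sum>x\<in>E. k' x * g x) + g e" for g :: "'e \<Rightarrow> nat"
    proof -
      have "(\<Sum>x\<in>E. k x * g x) = k e * g e + (\<Sum>x\<in>E - {e}. k x * g x)"
        using e(1) by (simp add: sum.remove)
      also have "(\<Sum>x\<in>E - {e}. k x * g x) = (\<Sum>x\<in>E - {e}. k' x * g x)"
        by (intro sum.cong) (auto simp: k'_def)
      also have "k e * g e = k' e * g e + g e" using e(2) by (cases "k e") (auto simp: k'_def)
      finally show ?thesis using e(1) by (simp add: sum.remove[of E e])
    qed
    have "Poly_Mapping.lookup (w e) i \<le> Poly_Mapping.lookup a i" for i
      using k(2)[of i] unfolding upd by simp
    then obtain b where b: "a = w e + b" using exp_split_iff by blast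
    have "sum k' E = n" using k(1) upd[of "\<lambda>_. 1"] by simp
    moreover have "(\<Sum>e\<in>E. k' e * Poly_Mapping.lookup (w e) i) \<le> Poly_Mapping.lookup b i" for i
      using k(2)[of i] unfolding upd by (simp add: b lookup_add)
    ultimately have "b \<in> power_exps (w ` E) n" using Suc by blast
    then show "a \<in> power_exps (w ` E) (Suc n)" using b e(1) by auto
  qed
qed

text \<open>The exponent of the generator \<open>t\<^sub>1 \<cdots> t\<^sub>s / t\<^sub>e\<close> of the dual ideal.\<close>

definition co_exp :: "'v::finite set \<Rightarrow> 'v \<Rightarrow>\<^sub>0 nat" where
  "co_exp e = set_exp (UNIV - e)"

lemma sum_co_exp:
  "(\<Sum>e\<in>E. c e * real (Poly_Mapping.lookup (co_exp e) i)) = sum c E - load E c i"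
  unfolding load_def sum_subtractf[symmetric]
  by (intro sum.cong) (auto simp: co_exp_def lookup_set_exp)

lemma power_exps_iff_covers:
  fixes E :: "'v::finite set set"
  shows "a \<in> power_exps (co_exp ` E) n \<longleftrightarrow> covers \<nat> E (\<lambda>i. real n - real (Poly_Mapping.lookup a i)) (real n)"
proof -
  have iff: "(\<Sum>e\<in>E. k e * Poly_Mapping.lookup (co_exp e) i) \<le> Poly_Mapping.lookup a i
      \<longleftrightarrow> real n - real (Poly_Mapping.lookup a i) \<le> load E (\<lambda>e. real (k e)) i" if "sum k E = n" for k i
  proof -
    have "real (\<Sum>e\<in>E. k e * Poly_Mapping.lookup (co_exp e) i) = real n - load E (\<lambda>e. real (k e)) i"
      using sum_co_exp[of "\<lambda>e. real (k e)" i E] that by auto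
    then show ?thesis by linarith
  qed
  show ?thesis
  proof
    assume "a \<in> power_exps (co_exp ` E) n"
    then obtain k where "sum k E = n"
      "\<forall>i. (\<Sum>e\<in>E. k e * Poly_Mapping.lookup (co_exp e) i) \<le> Poly_Mapping.lookup a i"
      by (auto simp: power_exps_iff_sums)
    then show "covers \<nat> E (\<lambda>i. real n - real (Poly_Mapping.lookup a i)) (real n)"
      unfolding covers_def using iff by (intro exI[of _ "\<lambda>e. real (k e)"]) auto
  next
    assume "covers \<nat> E (\<lambda>i. real n - real (Poly_Mapping.lookup a i)) (real n)"
    then obtain c where c: "\<forall>e\<in>E. c e \<in> \<nat>" "sum c E = real n"
      "\<forall>i. real n - real (Poly_Mapping.lookup a i) \<le> load E c i" by (auto simp: covers_def)
    define k where "k e = nat \<lfloor>c e\<rfloor>" for e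
    have k: "real (k e) = c e" if "e \<in> E" for e
      using c(1)[rule_format, OF that] by (auto simp: k_def elim!: Nats_cases)
    have "real (sum k E) = real n" using c(2) k by simp
    then have "sum k E = n" by (simp only: of_nat_eq_iff)
    moreover have "load E (\<lambda>e. real (k e)) i = load E c i" for i
      unfolding load_def using k by (intro sum.cong) auto
    ultimately show "a \<in> power_exps (co_exp ` E) n"
      unfolding power_exps_iff_sums using iff c(3) by (intro exI[of _ k]) auto
  qed
qed

lemma dual_edge_ideal_power:
  "ideal_power (dual_edge_ideal E) n
     = (supported_on (power_exps (co_exp ` E) n) :: ('v::finite, 'k::field) polyring set)"
proof (rule ideal_power_monomials)
  have "co_edge_monomial ` E = (\<lambda>w. Poly_Mapping.single w 1 :: ('v, 'k) polyring) ` co_exp ` E"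
    by (simp add: image_image co_edge_monomial_def prod_vars co_exp_def)
  then show "dual_edge_ideal E = (supported_on (multiples (co_exp ` E)) :: ('v, 'k) polyring set)"
    by (simp only: dual_edge_ideal_def ideal_gen_monomials)
qed

text \<open>The Newton polyhedron of the \<open>n\<close>-th power of the dual ideal is \<open>n\<close> times the convex hull of the
  exponents of the generators plus the nonnegative orthant. The coefficients of a convex
  combination, scaled by \<open>n\<close>, are the real weights of a cover.\<close>

lemma integral_over_dual_power_imp_covers:
  fixes f :: "('v::finite, 'k::field) polyring"
  assumes n: "1 \<le> n"
    and f: "f \<in> integral_closure (ideal_power (dual_edge_ideal E) n)" "a \<in> Poly_Mapping.keys f"
  shows "covers {0..} E (\<lambda>i. real n - real (Poly_Mapping.lookup a i)) (real n)"
proof -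
  let ?w = "\<lambda>e. real_exp (co_exp e) :: real ^ 'v"
  let ?H = "convex hull (?w ` E)" and ?O = "{z :: real ^ 'v. \<forall>i. 0 \<le> z $ i}"
  define D where "D = (\<Union>x\<in>(\<lambda>y. real n *\<^sub>R y) ` ?H. \<Union>z\<in>?O. {x + z})"
  have convO: "convex ?O" by (auto simp: convex_def)
  have closO: "closed ?O"
    by (intro closed_Collect_all closed_Collect_le continuous_intros)
  have convD: "convex D" unfolding D_def
    by (intro convex_sums convex_scaling convex_convex_hull convO)
  have closD: "closed D" unfolding D_def
    by (intro compact_closed_sums closO compact_scaling finite_imp_compact_convex_hull) simp
  have subD: "real_exp ` power_exps (co_exp ` E) n \<subseteq> D"
  proof clarify
    fix u assume "u \<in> power_exps (co_exp ` E) n"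
    then obtain k where k: "sum k E = n"
      "\<And>i. (\<Sum>e\<in>E. k e * Poly_Mapping.lookup (co_exp e) i) \<le> Poly_Mapping.lookup u i"
      by (auto simp: power_exps_iff_sums)
    define y where "y = (\<Sum>e\<in>E. (real (k e) / real n) *\<^sub>R ?w e)"
    have "(\<Sum>e\<in>E. real (k e) / real n) = 1"
      using n k(1) by (simp add: sum_divide_distrib[symmetric] of_nat_sum[symmetric] del: of_nat_sum)
    then have "y \<in> ?H" unfolding y_def
      by (intro convex_sum convex_convex_hull) (auto intro: hull_inc)
    moreover have "real n *\<^sub>R y = (\<Sum>e\<in>E. real (k e) *\<^sub>R ?w e)"
      using n by (simp add: y_def scaleR_sum_right)
    then have "real_exp u - real n *\<^sub>R y \<in> ?O"
    proof clarsimp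
      fix i
      have "real (\<Sum>e\<in>E. k e * Poly_Mapping.lookup (co_exp e) i) \<le> real (Poly_Mapping.lookup u i)"
        using k(2)[of i] by (simp only: of_nat_le_iff)
      then show "(\<Sum>e\<in>E. real (k e) * real_exp (co_exp e) $ i) \<le> real_exp u $ i"
        by (simp add: real_exp_def)
    qed
    moreover have "real_exp u = real n *\<^sub>R y + (real_exp u - real n *\<^sub>R y)" by simp
    ultimately show "real_exp u \<in> D" unfolding D_def by blast
  qed
  have "real_exp ` Poly_Mapping.keys f \<subseteq> D"
    by (rule integral_closure_Newton[OF _ convD closD subD f(1)[unfolded dual_edge_ideal_power]])
       (rule power_exps_add_right)
  then have "real_exp a \<in> D" using f(2) by blast
  then obtain y z where y: "y \<in> ?H" "z \<in> ?O" "real_exp a = real n *\<^sub>R y + z"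
    by (auto simp: D_def)
  have inj: "inj_on ?w E"
  proof (rule inj_onI)
    fix d e assume "?w d = ?w e"
    then have eq: "co_exp d = co_exp e" by (simp add: real_exp_inject)
    have "i \<in> d \<longleftrightarrow> i \<in> e" for i
      using arg_cong[OF eq, of "\<lambda>x. Poly_Mapping.lookup x i"]
      by (simp add: co_exp_def lookup_set_exp of_bool_def split: if_splits)
    then show "d = e" by blast
  qed
  obtain u where u: "\<And>x. x \<in> ?w ` E \<Longrightarrow> 0 \<le> u x" "sum u (?w ` E) = 1" "(\<Sum>x\<in>?w ` E. u x *\<^sub>R x) = y"
    using y(1) unfolding convex_hull_finite[OF finite_imageI[OF finite[of E]]] by blast
  define c where "c e = real n * u (?w e)" for e
  have c: "sum c E = real n"
    using u(2) by (simp add: c_def sum.reindex[OF inj] sum_distrib_left[symmetric])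
  moreover have "real n - real (Poly_Mapping.lookup a i) \<le> load E c i" for i
  proof -
    have "(\<Sum>e\<in>E. c e * real (Poly_Mapping.lookup (co_exp e) i)) = real n * (y $ i)"
    proof -
      have "y = (\<Sum>e\<in>E. u (?w e) *\<^sub>R ?w e)"
        using u(3) sum.reindex[OF inj, of "\<lambda>x. u x *\<^sub>R x"] by (simp only: o_def)
      then have "y $ i = (\<Sum>e\<in>E. u (?w e) * real (Poly_Mapping.lookup (co_exp e) i))"
        by (simp only: sum_component vector_scaleR_component real_exp_nth real_scaleR_def)
      then show ?thesis by (simp only: c_def sum_distrib_left mult.assoc)
    qed
    also have "\<dots> \<le> real_exp a $ i" using y(2,3) by simp
    finally show ?thesis unfolding sum_co_exp c by (simp add: real_exp_nth)
  qed
  ultimately show ?thesis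
    unfolding covers_def using u(1) by (intro exI[of _ c]) (auto simp: c_def)
qed

text \<open>By Dirichlet's theorem some multiple \<open>m\<close> of all weights is simultaneously close to integers.
  The data are integral, so replacing the multiplied weights by these integers changes each sum of
  weights by less than \<open>1\<close>, and an equation or inequality \<open>\<ge>\<close> with an integral right-hand
  side survives such a change once both sides are integral; this applies to the total, the loads
  and the signs of the weights.\<close>

lemma covers_rational:
  fixes E :: "'v::finite set set" and a :: "'v \<Rightarrow> nat"
  assumes "covers {0..} E (\<lambda>i. real n - real (a i)) (real n)"
  obtains m where "1 \<le> m" "covers \<nat> E (\<lambda>i. real (n * m) - real (m * a i)) (real (n * m))"
proof -
  obtain c where c: "\<forall>e\<in>E. (0::real) \<le> c e" "sum c E = real n" "\<And>i. real n - real (a i) \<le> load E c i"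
    using assms by (auto simp: covers_def)
  define K where "K = card E"
  obtain g where g: "bij_betw g {..<K} E"
    using ex_bij_betw_nat_finite[of E] by (auto simp: K_def atLeast0LessThan)
  obtain q p where q: "0 < q" and p: "\<And>j. j < K \<Longrightarrow> \<bar>of_int q * c (g j) - of_int (p j)\<bar> < 1 / real (Suc K)"
    using Dirichlet_approx_simult[of "Suc K" K "c \<circ> g"] by (metis comp_apply zero_less_Suc)
  define P where "P e = p (inv_into {..<K} g e)" for e
  have P: "\<bar>of_int q * c e - of_int (P e)\<bar> < 1 / real (Suc K)" if "e \<in> E" for e
    using p[of "inv_into {..<K} g e"] that g
    by (metis P_def bij_betw_inv_into_right bij_betw_imp_surj_on inv_into_into lessThan_iff)
  \<comment> \<open>At most \<open>K\<close> errors below \<open>1 / (K + 1)\<close> add up; \<open>h\<close> selects the edges that are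
      summed, all of them for the total and those through \<open>i\<close> for a load.\<close>
  have small: "\<bar>of_int q * (\<Sum>e\<in>E. h e * c e) - (\<Sum>e\<in>E. h e * of_int (P e))\<bar> < 1"
    if h: "\<And>e. h e \<in> {0, 1}" for h :: "'v set \<Rightarrow> real"
  proof -
    have "\<bar>of_int q * (\<Sum>e\<in>E. h e * c e) - (\<Sum>e\<in>E. h e * of_int (P e))\<bar>
        = \<bar>\<Sum>e\<in>E. h e * (of_int q * c e - of_int (P e))\<bar>"
      by (simp only: right_diff_distrib sum_subtractf sum_distrib_left mult.left_commute)
    also have "\<dots> \<le> (\<Sum>e\<in>E. 1 / real (Suc K))"
    proof (rule order_trans[OF sum_abs sum_mono])
      fix e assume "e \<in> E"
      then show "\<bar>h e * (of_int q * c e - of_int (P e))\<bar> \<le> 1 / real (Suc K)"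
        using P[of e] h[of e] by auto
    qed
    also have "\<dots> < 1" by (simp add: K_def)
    finally show ?thesis .
  qed
  have P0: "0 \<le> P e" if "e \<in> E" for e
  proof -
    have "0 \<le> of_int q * c e" using q c(1) that by simp
    moreover have "1 / real (Suc K) \<le> 1" by simp
    ultimately have "- 1 < real_of_int (P e)" using P[OF that] by linarith
    then show ?thesis by linarith
  qed
  define m where "m = nat q"
  have m: "real m = of_int q" "1 \<le> m" using q by (auto simp: m_def)
  have tot: "(\<Sum>e\<in>E. real_of_int (P e)) = real (n * m)"
  proof -
    have "\<bar>real_of_int (q * int n) - real_of_int (sum P E)\<bar> < 1"
      using small[of "\<lambda>_. 1"] c(2) by simp
    then have "q * int n = sum P E" by linarith
    then have "real_of_int (sum P E) = real_of_int (q * int n)" by simp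
    then show ?thesis using m(1) by simp
  qed
  have "real (n * m) - real (m * a i) \<le> load E (\<lambda>e. real_of_int (P e)) i" for i
  proof -
    define L where "L = (\<Sum>e\<in>E. of_bool (i \<in> e) * P e)"
    have L: "load E (\<lambda>e. real_of_int (P e)) i = real_of_int L"
      unfolding load_def L_def of_int_sum by (intro sum.cong) auto
    have "\<bar>of_int q * load E c i - load E (\<lambda>e. real_of_int (P e)) i\<bar> < 1"
      unfolding load_def by (rule small) auto
    moreover have "of_int q * (real n - real (a i)) \<le> of_int q * load E c i"
      using q c(3)[of i] by (intro mult_left_mono) auto
    ultimately have "real_of_int (q * (int n - int (a i))) - real_of_int L < 1" unfolding L by simp
    then have "q * (int n - int (a i)) \<le> L" by linarith
    then have "real_of_int (q * (int n - int (a i))) \<le> real_of_int L" by (simp only: of_int_le_iff)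
    then show ?thesis using m(1) L by (simp add: algebra_simps)
  qed
  then have "covers \<nat> E (\<lambda>i. real (n * m) - real (m * a i)) (real (n * m))"
    unfolding covers_def using tot P0 by (intro exI[of _ "\<lambda>e. real_of_int (P e)"]) (auto simp: Nats_altdef2)
  then show thesis using m(2) that by blast
qed

text \<open>By the Newton polyhedron, an element integral over the \<open>n\<close>-th power has only exponents \<open>a\<close>
  that admit a real cover of \<open>n - a\<close>. Conversely, a real cover of \<open>n - a\<close> yields a natural cover of
  some multiple \<open>m (n - a)\<close>, so that the \<open>m\<close>-th power of \<open>t\<^sup>a\<close> lies in the \<open>m\<close>-th power of that
  ideal power, and \<open>t\<^sup>a\<close> is integral over it. The \<open>n\<close>-th power itself consists of the polynomials
  all of whose exponents admit a natural cover.\<close>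

lemma normal_dual_edge_ideal_iff:
  fixes E :: "'v::finite set set"
  shows "normal_ideal (dual_edge_ideal E :: ('v, 'k::field) polyring set) \<longleftrightarrow> edge_decomposition E"
proof
  let ?J = "dual_edge_ideal E :: ('v, 'k) polyring set"
  assume normal: "normal_ideal ?J"
  show "edge_decomposition E"
    unfolding edge_decomposition_def
  proof (intro allI impI)
    fix n :: nat and a :: "'v \<Rightarrow> nat"
    assume n: "1 \<le> n" and "covers {0..} E (\<lambda>i. real n - real (a i)) (real n)"
    then obtain m where m: "1 \<le> m" "covers \<nat> E (\<lambda>i. real (n * m) - real (m * a i)) (real (n * m))"
      using covers_rational by blast
    define u where "u = (\<Sum>i\<in>UNIV. Poly_Mapping.single i (a i))"
    have u: "Poly_Mapping.lookup u i = a i" for i unfolding u_def lookup_sum_singles by simp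
    define f where "f = (Poly_Mapping.single u 1 :: ('v, 'k) polyring)"
    have pow: "ideal_power (ideal_power ?J n) j
        = supported_on (power_exps (power_exps (co_exp ` E) n) j)" for j
      by (rule ideal_power_monomials) (simp add: dual_edge_ideal_power multiples_power_exps)
    have "(\<Sum>i<m. u) \<in> power_exps (power_exps (co_exp ` E) n) m"
      using m(2) unfolding power_exps_mult power_exps_iff_covers by (simp add: lookup_sum u)
    then have "- (f ^ m) \<in> ideal_power (ideal_power ?J n) m"
      unfolding pow by (simp add: f_def single_power supported_on_def single_uminus[symmetric])
    then have "f \<in> integral_closure (ideal_power ?J n)"
      by (rule integral_closure_if_power_in[OF m(1)]) (simp add: pow supported_on_def)
    then have "f \<in> ideal_power ?J n" using normal n by (simp add: normal_ideal_def)
    then have "u \<in> power_exps (co_exp ` E) n"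
      by (simp add: dual_edge_ideal_power supported_on_def f_def)
    then show "covers \<nat> E (\<lambda>i. real n - real (a i)) (real n)"
      by (simp add: power_exps_iff_covers u)
  qed
next
  let ?J = "dual_edge_ideal E :: ('v, 'k) polyring set"
  assume P: "edge_decomposition E"
  show "normal_ideal ?J"
    unfolding normal_ideal_def
  proof (intro allI impI equalityI)
    fix n :: nat assume n: "1 \<le> n"
    show "ideal_power ?J n \<subseteq> integral_closure (ideal_power ?J n)"
      unfolding dual_edge_ideal_power
      by (intro subset_integral_closure subspace_supported_on power_exps_add_right)
    show "integral_closure (ideal_power ?J n) \<subseteq> ideal_power ?J n"
    proof
      fix f assume f: "f \<in> integral_closure (ideal_power ?J n)"
      have "a \<in> power_exps (co_exp ` E) n" if "a \<in> Poly_Mapping.keys f" for a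
        using integral_over_dual_power_imp_covers[OF n f that] P n
        unfolding power_exps_iff_covers edge_decomposition_def by blast
      then show "f \<in> ideal_power ?J n" by (auto simp: dual_edge_ideal_power supported_on_def)
    qed
  qed
qed

section \<open>The minimal generators of the edge ideal\<close>

lemma monomial_in_ideal_gen_iff:
  "(monomial v :: ('v::finite, 'k::field) polyring) \<in> ideal_gen (monomial ` W) \<longleftrightarrow> (\<exists>w\<in>W. w \<le> v)"
proof -
  define t where "t v = (\<Sum>i\<in>UNIV. Poly_Mapping.single i (v $ i))" for v :: "nat ^ 'v"
  have t: "Poly_Mapping.lookup (t v) i = v $ i" for v i unfolding t_def lookup_sum_singles by simp
  have mono: "monomial v = (Poly_Mapping.single (t v) 1 :: ('v, 'k) polyring)" for v
    by (simp add: monomial_def prod_var_powers t_def)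
  have "monomial ` W = (\<lambda>w. Poly_Mapping.single w 1 :: ('v, 'k) polyring) ` t ` W"
    by (simp add: mono image_image)
  then have "ideal_gen (monomial ` W) = (supported_on (multiples (t ` W)) :: ('v, 'k) polyring set)"
    by (simp only: ideal_gen_monomials)
  then have "(monomial v :: ('v, 'k) polyring) \<in> ideal_gen (monomial ` W) \<longleftrightarrow> (\<exists>w\<in>W. \<exists>c. t v = t w + c)"
    by (auto simp: mono supported_on_def multiples_def)
  also have "\<dots> \<longleftrightarrow> (\<exists>w\<in>W. w \<le> v)"
    unfolding exp_split_iff t less_eq_vec_def by simp
  finally show ?thesis .
qed

text \<open>Every generator in \<open>W\<close> is divisible by one in \<open>V\<close>, which is in turn divisible by one in \<open>W\<close>; for
  an antichain \<open>W\<close> all three agree. So \<open>V\<close> contains \<open>W\<close>, and minimality of \<open>V\<close> leaves no room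
  for more.\<close>

lemma min_monomial_gens_unique:
  assumes V: "min_monomial_gens V (ideal_gen (monomial ` W) :: ('v::finite, 'k::field) polyring set)"
    and W: "\<And>x y. x \<in> W \<Longrightarrow> y \<in> W \<Longrightarrow> x \<le> y \<Longrightarrow> x = y"
  shows "V = W"
proof -
  have eq: "ideal_gen (monomial ` V) = (ideal_gen (monomial ` W) :: ('v, 'k) polyring set)"
    using V by (simp add: min_monomial_gens_def)
  have le: "(\<exists>w\<in>W. w \<le> x) \<longleftrightarrow> (\<exists>v\<in>V. v \<le> x)" for x
    using monomial_in_ideal_gen_iff[of x W, where ?'k = 'k] monomial_in_ideal_gen_iff[of x V, where ?'k = 'k] eq by simp
  have "W \<subseteq> V"
  proof
    fix w assume w: "w \<in> W"
    then obtain v where v: "v \<in> V" "v \<le> w" using le by blast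
    then obtain w' where w': "w' \<in> W" "w' \<le> v" using le by blast
    have "w' = w" using w'(2) v(2) by (intro W[OF w'(1) w]) (rule order_trans)
    then have "v = w" using w'(2) v(2) by (simp add: antisym)
    then show "w \<in> V" using v(1) by simp
  qed
  moreover have "\<not> W \<subset> V" using V by (auto simp: min_monomial_gens_def)
  ultimately show ?thesis by auto
qed

definition edge_vec :: "'v::finite set \<Rightarrow> nat ^ 'v" where
  "edge_vec e = (\<chi> i. of_bool (i \<in> e))"

lemma edge_ideal_monomials: "edge_ideal E = (ideal_gen (monomial ` edge_vec ` E) :: ('v::finite, 'k::field) polyring set)"
proof -
  have "edge_monomial e = (monomial (edge_vec e) :: ('v, 'k) polyring)" for e
  proof -
    have "set_exp e = (\<Sum>i\<in>UNIV. Poly_Mapping.single i (edge_vec e $ i))"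
      by (rule poly_mapping_eqI) (simp add: lookup_set_exp lookup_sum_singles edge_vec_def)
    then show ?thesis
      by (simp add: edge_monomial_def monomial_def prod_vars prod_var_powers)
  qed
  then show ?thesis by (simp add: edge_ideal_def image_image)
qed

lemma basis_set_edge_vecs:
  "basis_set (edge_vec ` E) = (\<lambda>S. (indicator_vec S, 1)) ` graph_complex E"
proof -
  have "indicator_vec ({} :: 'a set) = 0" by (simp add: indicator_vec_def vec_eq_iff)
  moreover have "indicator_vec {i} = axis i 1" for i :: 'a
    by (simp add: indicator_vec_def vec_eq_iff axis_def of_bool_def)
  moreover have "(\<chi> i. real (edge_vec e $ i)) = indicator_vec e" for e :: "'a set"
    by (simp add: indicator_vec_def edge_vec_def vec_eq_iff)
  moreover have "basis_set (edge_vec ` E) = insert (0, 1)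
      (range (\<lambda>i. (axis i 1, 1)) \<union> (\<lambda>e. (\<chi> i. real (edge_vec e $ i), 1)) ` E)"
    by (auto simp: basis_set_def)
  ultimately show ?thesis
    by (simp only: graph_complex_def image_insert image_Un image_image)
qed

theorem corollary4p6:
  fixes E :: "'v::finite set set"
    and V :: "(nat ^ 'v) set"
    and I :: "('v, 'k::field) polyring set"
    and I_dual :: "('v, 'k) polyring set"
  assumes "simple_graph E"
    and "I = edge_ideal E"
    and "min_monomial_gens V I"
    and "I_dual = dual_edge_ideal E"
  shows "normal_ideal I_dual \<longleftrightarrow> hilbert_basis (basis_set V)"
proof -
  have card2: "\<forall>e\<in>E. card e = 2" using assms(1) by (simp add: simple_graph_def)
  \<comment> \<open>Edges have equal size, so none divides another and they are the minimal generators.\<close>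
  have "V = edge_vec ` E"
  proof (rule min_monomial_gens_unique)
    show "min_monomial_gens V (ideal_gen (monomial ` edge_vec ` E) :: ('v, 'k) polyring set)"
      using assms(2,3) edge_ideal_monomials by metis
  next
    fix x y assume "x \<in> edge_vec ` E" "y \<in> edge_vec ` E" "x \<le> y"
    then obtain d e where de: "d \<in> E" "e \<in> E" "x = edge_vec d" "y = edge_vec e" by auto
    then have "d \<subseteq> e" using \<open>x \<le> y\<close>
      by (auto simp: less_eq_vec_def edge_vec_def of_bool_def split: if_splits)
    then have "d = e" using card2 de(1,2) by (intro card_subset_eq) auto
    then show "x = y" using de by simp
  qed
  then have "hilbert_basis (basis_set V) \<longleftrightarrow> integer_decomposition (graph_complex E)"
    by (simp only: basis_set_edge_vecs hilbert_basis_iff_integer_decomposition)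
  also have "\<dots> \<longleftrightarrow> edge_decomposition E"
    using edge_decomposition_if_integer integer_decomposition_if_edge card2 by blast
  finally show ?thesis
    by (simp only: assms(4) normal_dual_edge_ideal_iff)
qed

end
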